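(* Let $c>0$ and $0<p<1$. (i) If $0<c\le\frac25$, then the map $L_{c,p}$ generates for every irrational $x\in[c,1]$ uncountably many different generalised Lüroth expansions. (ii) If $c=\frac1\ell$ for some $\ell\in\mathbb N_{\ge3}$, then $L_{c,p}$ generates for every irrational $x\in[c,1]$ uncountably many universal generalised Lüroth expansions.
   Context: Let $T_L:[0,1]\to[0,1]$ be the Lüroth map, $T_L(0)=0$, $T_L(1)=1$ and $T_L(x)=\lceil\frac1x\rceil(\lceil\frac1x\rceil-1)x-(\lceil\frac1x\rceil-1)$ for $x\ne0,1$, and let $T_A=1-T_L$ be the alternating Lüroth map. For $c\in(0,\frac12]$ put $z_n=\frac1n$ ($n\ge1$), $z_n^+=z_n+cz_nz_{n-1}$ ($n\ge2$), $z_n^-=z_n-cz_nz_{n+1}$ ($n\ge1$). Define $T_{0,c},T_{1,c}:[c,1]\to[c,1]$ by: $T_{0,c}(x)=T_A(x)$ if $x\in\bigcup_{n\ge2}[z_n,z_n^+)$ and $T_{0,c}(x)=T_L(x)$ if $x\in\{1\}\cup\bigcup_{n\ge2}[z_n^+,z_{n-1})$; $T_{1,c}(x)=T_A(x)$ if $x\in\bigcup_{n\ge2}[z_n,z_{n-1}^-]$ and $T_{1,c}(x)=T_L(x)$ if $x\in\{1\}\cup\bigcup_{n\ge2}(z_{n-1}^-,z_{n-1})$. Let $S=[c,1]\cap\bigcup_{n>1}[z_n^+,z_{n-1}^-]$. The random $c$-Lüroth transformation $L_{c,p}:\{0,1\}^{\mathbb N}\times[c,1]\to\{0,1\}^{\mathbb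 N}\times[c,1]$ is $L_{c,p}(\omega,x)=(\sigma(\omega),T_{\omega_1,c}(x))$, with $\sigma$ the left shift; the parameter $p$ is the probability with which $T_{0,c}$ is applied ($T_{1,c}$ being applied with probability $1-p$). For $x\in[c,1]$ let $s_1(\omega,x)=\omega_1$ if $x\in S$; $s_1(\omega,x)=0$ if $x=1$ or $x\in\bigcup_{n\ge1}(z_n^-,z_n)$; $s_1(\omega,x)=1$ if $x\in\bigcup_{n\ge2}[z_n,z_n^+)$. Let $d_1(\omega,x)=2$ if $x=1$ and $d_1(\omega,x)=n$ if $x\in[z_n,z_{n-1})$, $n\ge2$. For $i\ge1$ put $s_i(\omega,x)=s_1(L_{c,p}^{i-1}(\omega,x))$ and $d_i(\omega,x)=d_1(L_{c,p}^{i-1}(\omega,x))$. The sequence $((s_i(\omega,x),d_i(\omega,x)))_{i\ge1}$ is the generalised Lüroth expansion of $x$ generated by $L_{c,p}$ for $(\omega,x)$; it satisfies $x=\sum_{n\ge1}(-1)^{\sum_{i=1}^{n-1}s_i}\frac{d_n-1+s_n}{\prod_{i=1}^nd_i(d_i-1)}$. Its entries lie in the alphabet $\mathcal A_c=\{0,1\}\times\{2,3,\ldots,\lceil\frac1c\rceil\}$. It is called universal if every finite block of elements of $\mathcal A_c$ occurs in it. *)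

theory Defs
  imports Complex_Main "HOL-Library.Countable_Set"
begin

definition T_L :: "real \<Rightarrow> real" where
  "T_L x = (if x = 0 then 0 else if x = 1 then 1
     else of_int (\<lceil>1 / x\<rceil> * (\<lceil>1 / x\<rceil> - 1)) * x - of_int (\<lceil>1 / x\<rceil> - 1))"

definition T_A :: "real \<Rightarrow> real" where
  "T_A x = 1 - T_L x"

definition z :: "nat \<Rightarrow> real" where
  "z n = 1 / real n"

text \<open>\<open>z\<close> is only meaningful for \<open>n \<ge> 1\<close> and \<open>z_plus\<close> only for \<open>n \<ge> 2\<close>; all uses below
  respect these bounds.\<close>

definition z_plus :: "real \<Rightarrow> nat \<Rightarrow> real" where
  "z_plus c n = z n + c * z n * z (n - 1)"

definition z_minus :: "real \<Rightarrow> nat \<Rightarrow> real" where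
  "z_minus c n = z n - c * z n * z (n + 1)"

text \<open>For \<open>0 < c \<le> 1/2\<close>, the points of \<open>[c, 1]\<close> outside the union in \<open>T0\<close> are exactly those of
  \<open>{1} \<union> (\<Union>n\<ge>2. [z_plus c n, z (n - 1)))\<close>, and the points outside the union in \<open>T1\<close> are exactly
  those of \<open>{1} \<union> (\<Union>n\<ge>2. (z_minus c (n - 1), z (n - 1)))\<close>. Values outside \<open>[c, 1]\<close> are never
  used.\<close>

definition T0 :: "real \<Rightarrow> real \<Rightarrow> real" where
  "T0 c x = (if x \<in> (\<Union>n\<in>{2..}. {z n..<z_plus c n}) then T_A x else T_L x)"

definition T1 :: "real \<Rightarrow> real \<Rightarrow> real" where
  "T1 c x = (if x \<in> (\<Union>n\<in>{2..}. {z n..z_minus c (n - 1)}) then T_A x else T_L x)"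

definition switch_region :: "real \<Rightarrow> real set" where
  "switch_region c = {c..1} \<inter> (\<Union>n\<in>{2..}. {z_plus c n..z_minus c (n - 1)})"

text \<open>All sequences are indexed from \<open>0\<close>, so \<open>\<omega> 0\<close> is the first digit \<open>\<omega>\<^sub>1\<close>.\<close>

definition Omega :: "(nat \<Rightarrow> nat) set" where
  "Omega = {\<omega>. \<forall>i. \<omega> i \<in> {0, 1}}"

definition shift :: "(nat \<Rightarrow> nat) \<Rightarrow> nat \<Rightarrow> nat" where
  "shift \<omega> = (\<lambda>i. \<omega> (Suc i))"

text \<open>The parameter \<open>p\<close> is the probability with which the digit \<open>0\<close> (that is, the map \<open>T0\<close>) is
  chosen. It determines the Bernoulli measure on \<open>Omega\<close>, but not the values of the skew product
  itself, which is why it does not occur on the right-hand side.\<close>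

definition random_Lueroth ::
    "real \<Rightarrow> real \<Rightarrow> (nat \<Rightarrow> nat) \<times> real \<Rightarrow> (nat \<Rightarrow> nat) \<times> real" where
  "random_Lueroth c p = (\<lambda>(\<omega>, x). (shift \<omega>, if \<omega> 0 = 0 then T0 c x else T1 c x))"

text \<open>On \<open>[c, 1]\<close> the remaining case of \<open>sign_digit\<close> is \<open>x \<in> (\<Union>n\<ge>2. [z n, z_plus c n))\<close>.\<close>

definition sign_digit :: "real \<Rightarrow> (nat \<Rightarrow> nat) \<times> real \<Rightarrow> nat" where
  "sign_digit c = (\<lambda>(\<omega>, x).
     if x \<in> switch_region c then \<omega> 0
     else if x = 1 \<or> x \<in> (\<Union>n\<in>{1..}. {z_minus c n<..<z n}) then 0
     else 1)"

definition Lueroth_digit :: "(nat \<Rightarrow> nat) \<times> real \<Rightarrow> nat" where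
  "Lueroth_digit = (\<lambda>(\<omega>, x).
     if x = 1 then 2 else (THE n. n \<ge> 2 \<and> x \<in> {z n..<z (n - 1)}))"

definition Lueroth_expansion ::
    "real \<Rightarrow> real \<Rightarrow> (nat \<Rightarrow> nat) \<Rightarrow> real \<Rightarrow> nat \<Rightarrow> nat \<times> nat" where
  "Lueroth_expansion c p \<omega> x = (\<lambda>i.
     let y = (random_Lueroth c p ^^ i) (\<omega>, x) in (sign_digit c y, Lueroth_digit y))"

definition alphabet :: "real \<Rightarrow> (nat \<times> nat) set" where
  "alphabet c = {0, 1} \<times> {2..nat \<lceil>1 / c\<rceil>}"

definition universal_expansion :: "real \<Rightarrow> (nat \<Rightarrow> nat \<times> nat) \<Rightarrow> bool" where
  "universal_expansion c a \<longleftrightarrow>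
     (\<forall>B. set B \<subseteq> alphabet c \<longrightarrow> (\<exists>k. \<forall>i<length B. a (k + i) = B ! i))"

end

theory Submission
  imports Defs "HOL-Analysis.Kronecker_Approximation_Theorem" "HOL-Number_Theory.Residues"
begin

text \<open>
  Write \<open>t = T_L y\<close>. A random orbit at an irrational \<open>y\<close> may move to \<open>t\<close> (sign 0) or to \<open>1 - t\<close> (sign 1)
  exactly when the value is at least \<open>c\<close>; both are possible iff \<open>y \<in> S\<close>. For \<open>c \<le> 2/5\<close> every
  irrational orbit visits \<open>S\<close> infinitely often, so each given expansion is avoided on a dense open
  set of \<open>\<omega>\<close>. For \<open>c = 1/l\<close> every block is read on some subinterval of \<open>[c, 1]\<close>, so, provided every
  subinterval can be reached, each block occurs for a dense open set of \<open>\<omega>\<close>. Both parts follow by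
  Baire category: a countable set of expansions is avoided by some \<open>\<omega>\<close> satisfying all conditions.

  Reaching a subinterval: up to sign and modulo 1, the class of \<open>t\<close> can always be multiplied by 2,
  and by 6 when its distance to \<open>\<int>\<close> is at least \<open>1/3\<close>. As doubling always leads back to the
  latter situation, for each \<open>j\<close> all \<open>2\<^sup>i 3\<^sup>j t\<close> with \<open>i\<close> large occur. These are dense
  modulo 1 by Furstenberg's \<open>\<times>2\<times>3\<close> theorem, for which Boshernitzan's elementary proof is used.
\<close>

section \<open>Furstenberg's theorem\<close>

text \<open>A subset of \<open>\<real> / \<int>\<close> is represented by its preimage in
  \<open>\<real>\<close>, so that closedness, limit points and scaling are those of the real
  line.\<close>

definition one_periodic :: "real set \<Rightarrow> bool" where
  "one_periodic A \<longleftrightarrow> (\<forall>x\<in>A. \<forall>m::int. x + of_int m \<in> A)"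

definition times_invariant :: "nat \<Rightarrow> real set \<Rightarrow> bool" where
  "times_invariant k A \<longleftrightarrow> (\<forall>x\<in>A. real k * x \<in> A)"

text \<open>For a \<open>one_periodic\<close> set this says that its image in
  \<open>\<real> / \<int>\<close> is infinite.\<close>

definition small_differences :: "real set \<Rightarrow> bool" where
  "small_differences A \<longleftrightarrow> (\<forall>\<epsilon>>0. \<exists>u\<in>A. \<exists>v\<in>A. u \<noteq> v \<and> \<bar>u - v\<bar> < \<epsilon>)"

lemma one_periodicD: "one_periodic A \<Longrightarrow> x \<in> A \<Longrightarrow> x + of_int m \<in> A"
  by (simp add: one_periodic_def)

lemma times_invariantD: "times_invariant k A \<Longrightarrow> x \<in> A \<Longrightarrow> real k * x \<in> A"
  by (simp add: times_invariant_def)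

lemma times_invariant_power:
  assumes "times_invariant k A" shows "times_invariant (k ^ n) A"
proof (induction n)
  case 0 then show ?case by (simp add: times_invariant_def)
next
  case (Suc n)
  then show ?case using assms unfolding times_invariant_def by (simp add: mult.assoc)
qed

section \<open>The multiplicative semigroup of powers of 2 and 3\<close>

text \<open>Start from the largest multiple of \<beta> not above \<open>L\<close> and exchange
  \<open>n\<close> copies of \<beta> for \<open>m\<close> copies of \<alpha> repeatedly. Each
  exchange adds less than \<delta>, so the sum cannot jump over the interval.\<close>

lemma positive_combination_hits_interval:
  fixes \<alpha> \<beta> \<delta> :: real and m n :: nat
  assumes "\<alpha> > 0" "\<beta> > 0" and d: "0 < m * \<alpha> - n * \<beta>" "m * \<alpha> - n * \<beta> < \<delta>"
  shows "\<exists>L0. \<forall>L\<ge>L0. \<exists>(i::nat) (j::nat). L < i * \<alpha> + j * \<beta> \<and> i * \<alpha> + j * \<beta> < L + \<delta>"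
proof -
  define d where "d = m * \<alpha> - n * \<beta>"
  \<comment> \<open>At most \<open>\<beta> / d + 1\<close> exchanges occur, each consuming
    \<open>n\<close> copies of \<beta>; from \<open>L0\<close> on there are enough copies.\<close>
  define L0 where "L0 = \<beta> * (n * (\<beta> / d + 1) + 1)"
  have dpos: "d > 0" and dless: "d < \<delta>" using d by (auto simp: d_def)
  have L0: "L0 \<ge> 0" unfolding L0_def using assms dpos by simp
  have "\<exists>(i::nat) (j::nat). L < i * \<alpha> + j * \<beta> \<and> i * \<alpha> + j * \<beta> < L + \<delta>" if L: "L \<ge> L0" for L
  proof -
    define j where "j = nat \<lfloor>L / \<beta>\<rfloor>"
    \<comment> \<open>The least number of exchanges that carries the sum strictly beyond
      \<open>L\<close>.\<close>
    define k where "k = nat (\<lfloor>(L - j * \<beta>) / d\<rfloor> + 1)"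
    have j: "real j = of_int \<lfloor>L / \<beta>\<rfloor>" unfolding j_def using L L0 assms by simp
    have "real j \<le> L / \<beta>" "L / \<beta> < real j + 1" unfolding j by linarith+
    then have jb: "j * \<beta> \<le> L" "L < j * \<beta> + \<beta>" using assms by (auto simp: field_simps)
    have k: "real k = of_int \<lfloor>(L - j * \<beta>) / d\<rfloor> + 1" unfolding k_def using jb dpos by simp
    have k1: "real k > (L - j * \<beta>) / d" "real k \<le> (L - j * \<beta>) / d + 1" unfolding k by linarith+
    then have kd: "real k * d > L - j * \<beta>" "real k * d \<le> L - j * \<beta> + d"
      using dpos by (auto simp: field_simps)
    have "(L - j * \<beta>) / d \<le> \<beta> / d" using jb dpos by (intro divide_right_mono) auto
    then have "real k \<le> \<beta> / d + 1" using k1 by linarith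
    then have "real n * real k \<le> n * (\<beta> / d + 1)" by (intro mult_left_mono) auto
    also have "\<dots> = L0 / \<beta> - 1" unfolding L0_def using assms by (simp add: field_simps)
    also have "\<dots> \<le> L / \<beta> - 1" using L assms by (simp add: divide_right_mono)
    also have "\<dots> \<le> j" using \<open>L / \<beta> < real j + 1\<close> by simp
    finally have "n * k \<le> j" by (metis of_nat_le_iff of_nat_mult)
    then have "real (k * m) * \<alpha> + real (j - n * k) * \<beta> = j * \<beta> + k * d"
      by (simp add: of_nat_diff d_def algebra_simps)
    then have "L < real (k * m) * \<alpha> + real (j - n * k) * \<beta> \<and> real (k * m) * \<alpha> + real (j - n * k) * \<beta> < L + \<delta>"
      using kd dless by linarith
    then show ?thesis by blast
  qed
  then show ?thesis by blast
qed

text \<open>Dirichlet approximation of \<open>ln 2 / ln 3\<close>. The difference is nonzero because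
  a power of 3 is odd.\<close>

lemma ln2_ln3_approx:
  fixes \<delta> :: real
  assumes "\<delta> > 0"
  obtains m n :: nat where "m * ln 2 - n * ln 3 \<noteq> (0::real)" "\<bar>m * ln 2 - n * ln 3\<bar> < \<delta>"
proof -
  obtain N :: nat where N: "real N > ln 3 / \<delta>" "N > 0"
    by (metis assms divide_pos_pos gr0I ln_gt_zero not_less of_nat_0 one_less_numeral_iff order_less_asym' reals_Archimedean2 semiring_norm(77))
  obtain h k where hk: "0 < k" "\<bar>of_int k * (ln 2 / ln 3) - of_int h\<bar> < 1 / real N"
    using Dirichlet_approx[OF N(2), of "ln 2 / ln 3"] by metis
  have l3: "ln (3::real) > 0" by simp
  have h0: "h \<ge> 0"
  proof (rule ccontr)
    assume "\<not> h \<ge> 0"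
    then have "real_of_int h \<le> -1" by linarith
    moreover have "of_int k * (ln 2 / ln 3 :: real) > 0" using hk by simp
    moreover have "1 / real N \<le> 1" using N by simp
    ultimately show False using hk by linarith
  qed
  define m n where "m = nat k" and "n = nat h"
  have mn: "real m = of_int k" "real n = of_int h" "m > 0" using hk h0 by (auto simp: m_def n_def)
  have eq: "m * ln 2 - n * ln 3 = ln 3 * (of_int k * (ln 2 / ln 3) - of_int h)"
    using l3 by (simp add: mn field_simps)
  have "\<bar>m * ln 2 - n * ln 3\<bar> = ln 3 * \<bar>of_int k * (ln 2 / ln 3) - of_int h\<bar>"
    unfolding eq by (simp add: abs_mult)
  also have "\<dots> < ln 3 * (1 / real N)" using hk l3 by (intro mult_strict_left_mono) auto
  also have "\<dots> < \<delta>" using N assms by (simp add: field_simps)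
  finally have 1: "\<bar>m * ln 2 - n * ln 3\<bar> < \<delta>" .
  have "m * ln 2 - n * ln 3 \<noteq> (0::real)"
  proof
    assume "m * ln 2 - n * ln 3 = (0::real)"
    then have "ln ((2::real) ^ m) = ln (3 ^ n)" by (simp add: ln_realpow)
    then have "(2::real) ^ m = 3 ^ n" by simp
    then have "(2::nat) ^ m = 3 ^ n" by (metis of_nat_eq_iff of_nat_numeral of_nat_power)
    then have "even ((3::nat) ^ n)" using mn by (metis dvd_power even_numeral)
    then show False by simp
  qed
  with 1 that show ?thesis by blast
qed

text \<open>After taking logarithms, \<open>x\<close> small becomes \<open>ln a - ln x\<close>
  large, and the additive statement about combinations of \<open>u * ln 2\<close> and
  \<open>u * ln 3\<close> applies.\<close>

lemma power_2_3_hits_interval: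
  fixes a b :: real
  assumes "u > 0" "0 < a" "a < b"
  obtains X where "X > 0"
    "\<And>x. 0 < x \<Longrightarrow> x < X \<Longrightarrow> \<exists>i j. a < (2 ^ u) ^ i * (3 ^ u) ^ j * x \<and> (2 ^ u) ^ i * (3 ^ u) ^ j * x < b"
proof -
  define \<delta> where "\<delta> = ln b - ln a"
  have \<delta>: "\<delta> > 0" using assms by (simp add: \<delta>_def)
  define \<alpha> \<beta> :: real where "\<alpha> = u * ln 2" and "\<beta> = u * ln 3"
  have pos: "\<alpha> > 0" "\<beta> > 0" using assms by (auto simp: \<alpha>_def \<beta>_def)
  obtain m n :: nat where mn: "m * ln 2 - n * ln 3 \<noteq> (0::real)" "\<bar>m * ln 2 - n * ln 3\<bar> < \<delta> / u"
    using ln2_ln3_approx[of "\<delta> / u"] \<delta> assms by auto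
  have eq: "m * \<alpha> - n * \<beta> = u * (m * ln 2 - n * ln 3)" by (simp add: \<alpha>_def \<beta>_def algebra_simps)
  have ne: "m * \<alpha> - n * \<beta> \<noteq> 0" unfolding eq using mn assms by simp
  have "\<bar>m * \<alpha> - n * \<beta>\<bar> = u * \<bar>m * ln 2 - n * ln 3\<bar>" unfolding eq by (simp add: abs_mult)
  also have "\<dots> < u * (\<delta> / u)" using mn assms by (intro mult_strict_left_mono) auto
  finally have less: "\<bar>m * \<alpha> - n * \<beta>\<bar> < \<delta>" using assms by simp
  have "\<exists>L0. \<forall>L\<ge>L0. \<exists>(i::nat) (j::nat). L < i * \<alpha> + j * \<beta> \<and> i * \<alpha> + j * \<beta> < L + \<delta>"
  proof (cases "m * \<alpha> - n * \<beta> > 0")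
    case True
    then show ?thesis using positive_combination_hits_interval[of \<alpha> \<beta> m n \<delta>] pos less by simp
  next
    \<comment> \<open>A negative difference is handled by exchanging the roles of 2 and 3.\<close>
    case False
    then obtain L0 where L0: "\<And>L. L \<ge> L0 \<Longrightarrow> \<exists>(i::nat) (j::nat). L < i * \<beta> + j * \<alpha> \<and> i * \<beta> + j * \<alpha> < L + \<delta>"
      using positive_combination_hits_interval[of \<beta> \<alpha> n m \<delta>] pos less ne by auto
    show ?thesis
    proof (intro exI[of _ L0] allI impI)
      fix L assume "L \<ge> L0"
      then obtain i j :: nat where "L < i * \<beta> + j * \<alpha>" "i * \<beta> + j * \<alpha> < L + \<delta>" using L0 by blast
      then show "\<exists>(i::nat) (j::nat). L < i * \<alpha> + j * \<beta> \<and> i * \<alpha> + j * \<beta> < L + \<delta>"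
        by (intro exI[of _ j] exI[of _ i]) (simp add: add.commute)
    qed
  qed
  then obtain L0 where L0: "\<And>L. L \<ge> L0 \<Longrightarrow> \<exists>(i::nat) (j::nat). L < i * \<alpha> + j * \<beta> \<and> i * \<alpha> + j * \<beta> < L + \<delta>"
    by blast
  show ?thesis
  proof (rule that[of "a * exp (- L0)"])
    show "a * exp (- L0) > 0" using assms by simp
    fix x :: real assume x: "0 < x" "x < a * exp (- L0)"
    have "ln x < ln (a * exp (- L0))" using x by (subst ln_less_cancel_iff) auto
    also have "\<dots> = ln a - L0" using assms by (simp add: ln_mult)
    finally have "ln a - ln x \<ge> L0" by simp
    then obtain i j :: nat where ij: "ln a - ln x < i * \<alpha> + j * \<beta>" "i * \<alpha> + j * \<beta> < ln a - ln x + \<delta>"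
      using L0 by blast
    have eq: "ln ((2 ^ u) ^ i * (3 ^ u) ^ j * x) = i * \<alpha> + j * \<beta> + ln x"
      using x by (simp add: ln_mult ln_realpow \<alpha>_def \<beta>_def)
    have "ln a < ln ((2 ^ u) ^ i * (3 ^ u) ^ j * x)" "ln ((2 ^ u) ^ i * (3 ^ u) ^ j * x) < ln b"
      unfolding eq using ij by (auto simp: \<delta>_def)
    then show "\<exists>i j. a < (2 ^ u) ^ i * (3 ^ u) ^ j * x \<and> (2 ^ u) ^ i * (3 ^ u) ^ j * x < b"
      using assms x by (intro exI[of _ i] exI[of _ j]) auto
  qed
qed

text \<open>A small positive element can be multiplied into any short interval to the right of a
  positive target, so the closed set \<open>A\<close> contains every positive real and, by
  periodicity, every real.\<close>

lemma UNIV_if_small_positive_elements: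
  assumes A: "closed A" "one_periodic A" "times_invariant (2 ^ u) A" "times_invariant (3 ^ u) A"
    and u: "u > 0" and small: "\<And>\<epsilon>. \<epsilon> > 0 \<Longrightarrow> \<exists>x\<in>A. 0 < x \<and> x < \<epsilon>"
  shows "A = UNIV"
proof -
  have "y \<in> A" for y
  proof -
    \<comment> \<open>Translating by an integer makes the target positive, which scaling of positive
      elements requires.\<close>
    define y' where "y' = frac y + 1"
    have y': "y' > 0" by (simp add: y'_def add_nonneg_pos)
    have "y' \<in> closure A"
      unfolding closure_approachable
    proof (intro allI impI)
      fix e :: real assume e: "e > 0"
      obtain X where X: "X > 0" "\<And>x. 0 < x \<Longrightarrow> x < X \<Longrightarrow>
          \<exists>i j. y' < (2 ^ u) ^ i * (3 ^ u) ^ j * x \<and> (2 ^ u) ^ i * (3 ^ u) ^ j * x < y' + e"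
        using power_2_3_hits_interval[OF u y', of "y' + e"] e by auto
      obtain x where x: "x \<in> A" "0 < x" "x < X" using small[OF X(1)] by blast
      obtain i j where ij: "y' < (2 ^ u) ^ i * (3 ^ u) ^ j * x" "(2 ^ u) ^ i * (3 ^ u) ^ j * x < y' + e"
        using X(2) x by blast
      have "real ((2 ^ u) ^ i) * (real ((3 ^ u) ^ j) * x) \<in> A"
        using x A times_invariant_power times_invariantD by meson
      then have "(2 ^ u) ^ i * (3 ^ u) ^ j * x \<in> A" by (simp add: mult.assoc)
      then show "\<exists>z\<in>A. dist z y' < e" using ij by (intro bexI) (auto simp: dist_real_def)
    qed
    then have "y' \<in> A" using A by (simp add: closure_closed)
    then have "y' + of_int (\<lfloor>y\<rfloor> - 1) \<in> A" using A one_periodicD by blast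
    then show ?thesis by (simp add: y'_def frac_def)
  qed
  then show ?thesis by blast
qed

text \<open>If there are no arbitrarily small positive elements, the small ones are negative and the
  positive case applies to the reflected set.\<close>

lemma UNIV_if_small_elements:
  assumes A: "closed A" "one_periodic A" "times_invariant (2 ^ u) A" "times_invariant (3 ^ u) A"
    and u: "u > 0" and small: "\<And>\<epsilon>. \<epsilon> > 0 \<Longrightarrow> \<exists>x\<in>A. x \<noteq> 0 \<and> \<bar>x\<bar> < \<epsilon>"
  shows "A = UNIV"
proof (cases "\<forall>\<epsilon>>0. \<exists>x\<in>A. 0 < x \<and> x < \<epsilon>")
  case True
  then show ?thesis using UNIV_if_small_positive_elements[OF A u] by blast
next
  case False
  then obtain e where e: "e > 0" "\<And>x. x \<in> A \<Longrightarrow> \<not> (0 < x \<and> x < e)" by blast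
  have neg: "uminus ` A = UNIV"
  proof (rule UNIV_if_small_positive_elements[OF _ _ _ _ u])
    show "closed (uminus ` A)" using A closed_negations by blast
    show "one_periodic (uminus ` A)"
      unfolding one_periodic_def
    proof (safe)
      fix x m assume "x \<in> A"
      then have "x + of_int (- m) \<in> A" using A one_periodicD by blast
      then show "- x + of_int m \<in> uminus ` A" by (intro image_eqI[of _ _ "x - of_int m"]) auto
    qed
    show "times_invariant (2 ^ u) (uminus ` A)" "times_invariant (3 ^ u) (uminus ` A)"
      using A unfolding times_invariant_def by auto
    fix \<epsilon> :: real assume "\<epsilon> > 0"
    then obtain x where "x \<in> A" "x \<noteq> 0" "\<bar>x\<bar> < min e \<epsilon>" using small[of "min e \<epsilon>"] e by auto
    then show "\<exists>x\<in>uminus ` A. 0 < x \<and> x < \<epsilon>" using e(2)[of x] by (intro bexI[of _ "- x"]) auto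
  qed
  have "x \<in> A" for x
  proof -
    have "- x \<in> uminus ` A" using neg by simp
    then show ?thesis by auto
  qed
  then show ?thesis by blast
qed

section \<open>Fractions with denominator coprime to 6\<close>

text \<open>Used to turn an arbitrary rational, by multiplication with powers of 2 and 3, into one
  whose denominator is coprime to 6.\<close>

lemma coprime_6_part:
  fixes n :: nat
  assumes "n > 0"
  shows "\<exists>i j q. n = 2 ^ i * 3 ^ j * q \<and> coprime q 6"
  using assms
proof (induction n rule: less_induct)
  case (less n)
  consider k where "n = 2 * k" | k where "n = 3 * k" | "\<not> 2 dvd n" "\<not> 3 dvd n" by (metis dvdE)
  then show ?case
  proof cases
    case 1
    then have "k < n" "k > 0" using less.prems by simp_all
    then obtain i j q where "k = 2 ^ i * 3 ^ j * q" "coprime q 6" using less.IH by blast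
    then show ?thesis using 1 by (intro exI[of _ "Suc i"] exI[of _ j] exI[of _ q]) auto
  next
    case 2
    then have "k < n" "k > 0" using less.prems by simp_all
    then obtain i j q where "k = 2 ^ i * 3 ^ j * q" "coprime q 6" using less.IH by blast
    then show ?thesis using 2 by (intro exI[of _ i] exI[of _ "Suc j"] exI[of _ q]) auto
  next
    case 3
    have "coprime 2 n" "coprime 3 n" using 3 by (auto intro: prime_imp_coprime)
    then have "coprime n 2" "coprime n 3" by (simp_all add: coprime_commute)
    then have "coprime n (2 * 3)" using coprime_mult_right_iff by blast
    then show ?thesis by (intro exI[of _ 0] exI[of _ n]) auto
  qed
qed

text \<open>Euler's theorem with \<open>u = totient q\<close>. Multiplication by
  \<open>2 ^ u\<close> and by \<open>3 ^ u\<close> then fixes every fraction with denominator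
  \<open>q\<close> modulo 1.\<close>

lemma coprime_6_exponent:
  assumes "coprime q (6::nat)"
  obtains u where "u > 0" "int q dvd 2 ^ u - 1" "int q dvd 3 ^ u - 1"
proof -
  have co: "coprime 2 q" "coprime 3 q"
    using assms coprime_mult_right_iff[of q 2 3] by (auto simp: coprime_commute)
  have "[2 ^ totient q = 1] (mod q)" "[3 ^ totient q = 1] (mod q)"
    using co euler_theorem by blast+
  then have "[int (2 ^ totient q) = int 1] (mod int q)" "[int (3 ^ totient q) = int 1] (mod int q)"
    using cong_int_iff by blast+
  then have "int q dvd 2 ^ totient q - 1" "int q dvd 3 ^ totient q - 1"
    by (auto simp: cong_iff_dvd_diff)
  moreover have "totient q > 0" using assms by (cases "q = 0") auto
  ultimately show ?thesis using that by blast
qed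


section \<open>Limit points and small differences\<close>

lemma one_periodic_limpt:
  assumes "one_periodic A" shows "one_periodic {x. x islimpt A}"
  unfolding one_periodic_def
proof safe
  fix x :: real and m :: int assume x: "x islimpt A"
  show "x + of_int m islimpt A"
    unfolding islimpt_approachable
  proof (intro allI impI)
    fix e :: real assume "e > 0"
    then obtain y where "y \<in> A" "y \<noteq> x" "dist y x < e" using x islimpt_approachable by blast
    then show "\<exists>y\<in>A. y \<noteq> x + of_int m \<and> dist y (x + of_int m) < e"
      using one_periodicD[OF assms, of y m] by (intro bexI[of _ "y + of_int m"]) (auto simp: dist_real_def)
  qed
qed

lemma times_invariant_limpt:
  assumes "times_invariant k A" "k > 0" shows "times_invariant k {x. x islimpt A}"
  unfolding times_invariant_def
proof safe
  fix x :: real assume x: "x islimpt A"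
  show "real k * x islimpt A"
    unfolding islimpt_approachable
  proof (intro allI impI)
    fix e :: real assume "e > 0"
    then have "e / k > 0" using assms by simp
    then obtain y where y: "y \<in> A" "y \<noteq> x" "dist y x < e / k" using x islimpt_approachable by blast
    have "dist (real k * y) (real k * x) = k * dist y x"
      by (simp add: dist_real_def abs_mult flip: right_diff_distrib)
    then show "\<exists>y\<in>A. y \<noteq> real k * x \<and> dist y (real k * x) < e"
      using y assms times_invariantD[OF assms(1) y(1)]
      by (intro bexI[of _ "real k * y"]) (auto simp: field_simps)
  qed
qed

text \<open>Multiplying \<open>r\<close> by powers of 2 and 3 gives a limit point \<open>r'\<close>
  with denominator coprime to 6, which suitable \<open>2 ^ u\<close> and \<open>3 ^ u\<close> fix
  modulo 1. Translating \<open>r'\<close> to 0 keeps invariance under these two factors and produces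
  arbitrarily small nonzero elements.\<close>

lemma UNIV_if_rational_limpt:
  assumes A: "closed A" "one_periodic A" "times_invariant 2 A" "times_invariant 3 A"
    and r: "r \<in> \<rat>" "r islimpt A"
  shows "A = UNIV"
proof -
  obtain a :: int and b :: nat where ab: "b > 0" "r = of_int a / of_nat b"
    using r(1) by (metis Rats_cases' of_int_of_nat_eq zero_less_imp_eq_int of_nat_0_less_iff)
  obtain i j q where q: "b = 2 ^ i * 3 ^ j * q" "coprime q 6" using coprime_6_part ab by blast
  obtain u where u: "u > 0" "int q dvd 2 ^ u - 1" "int q dvd 3 ^ u - 1" using coprime_6_exponent q by blast
  have qpos: "q > 0" using ab q by (cases "q = 0") auto
  define r' where "r' = of_int a / real q"
  have "times_invariant (3 ^ j) {x. x islimpt A}" "times_invariant (2 ^ i) {x. x islimpt A}"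
    using A by (auto intro!: times_invariant_power times_invariant_limpt)
  then have "real (2 ^ i) * (real (3 ^ j) * r) \<in> {x. x islimpt A}"
    using r unfolding times_invariant_def by blast
  also have "real (2 ^ i) * (real (3 ^ j) * r) = r'" using ab q by (simp add: r'_def)
  finally have r': "r' islimpt A" by simp
  define C where "C = (\<lambda>x. - r' + x) ` A"
  have fixed: "\<exists>m. real (k ^ u) * r' = r' + of_int m" if d: "int q dvd int k ^ u - 1" for k
  proof -
    obtain w where "int k ^ u - 1 = int q * w" using d by blast
    then have "real_of_int (int k ^ u - 1) = real_of_int (int q * w)" by simp
    then have "real (k ^ u) = 1 + q * of_int w" by simp
    then have "real (k ^ u) * r' = r' + of_int (w * a)" using qpos by (simp add: r'_def field_simps)
    then show ?thesis by blast
  qed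
  have inv: "times_invariant (k ^ u) C" if k: "int q dvd int k ^ u - 1" "times_invariant k A" for k
    unfolding times_invariant_def C_def
  proof safe
    fix x assume x: "x \<in> A"
    obtain m where m: "real (k ^ u) * r' = r' + of_int m" using fixed[OF k(1)] by blast
    have "real (k ^ u) * x + of_int (- m) \<in> A"
      using one_periodicD[OF A(2) times_invariantD[OF times_invariant_power[OF k(2)] x]] .
    moreover have "real (k ^ u) * (- r' + x) = - r' + (real (k ^ u) * x + of_int (- m))"
      using m by (simp add: algebra_simps)
    ultimately show "real (k ^ u) * (- r' + x) \<in> (\<lambda>x. - r' + x) ` A" by (metis imageI)
  qed
  have "C = UNIV"
  proof (rule UNIV_if_small_elements[OF _ _ _ _ u(1)])
    show "closed C" unfolding C_def using A by (intro closed_translation)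
    show "one_periodic C" unfolding one_periodic_def C_def
    proof safe
      fix x and m :: int assume "x \<in> A"
      then have "x + of_int m \<in> A" using A one_periodicD by blast
      then show "- r' + x + of_int m \<in> (\<lambda>x. - r' + x) ` A" by (metis imageI add.assoc)
    qed
    show "times_invariant (2 ^ u) C" "times_invariant (3 ^ u) C" using inv[of 2] inv[of 3] u A by auto
    fix \<epsilon> :: real assume "\<epsilon> > 0"
    then obtain x where "x \<in> A" "x \<noteq> r'" "dist x r' < \<epsilon>" using r' islimpt_approachable by blast
    then show "\<exists>x\<in>C. x \<noteq> 0 \<and> \<bar>x\<bar> < \<epsilon>" unfolding C_def
      by (intro bexI[of _ "- r' + x"]) (auto simp: dist_real_def)
  qed
  have "x \<in> A" for x
  proof -
    have "- r' + x \<in> C" using \<open>C = UNIV\<close> by simp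
    then show ?thesis by (auto simp: C_def)
  qed
  then show ?thesis by blast
qed

lemma infinite_small_differences:
  assumes "infinite S" "S \<subseteq> {0..1}" "S \<subseteq> A"
  shows "small_differences A"
proof -
  obtain l where l: "l islimpt S"
    using assms by (metis compact_Icc compact_eq_Bolzano_Weierstrass)
  show ?thesis unfolding small_differences_def
  proof (intro allI impI)
    fix \<epsilon> :: real assume e: "\<epsilon> > 0"
    then obtain u where u: "u \<in> S" "u \<noteq> l" "dist u l < \<epsilon> / 2"
      using l islimpt_approachable by (metis half_gt_zero)
    \<comment> \<open>Choosing \<open>v\<close> strictly closer to \<open>l\<close> than
      \<open>u\<close> guarantees that the two points differ.\<close>
    then obtain v where v: "v \<in> S" "v \<noteq> l" "dist v l < dist u l"
      using l islimpt_approachable by (metis zero_less_dist_iff)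
    have "u \<noteq> v" using v by auto
    moreover have "\<bar>u - v\<bar> < \<epsilon>" using u v unfolding dist_real_def by linarith
    ultimately show "\<exists>u\<in>A. \<exists>v\<in>A. u \<noteq> v \<and> \<bar>u - v\<bar> < \<epsilon>" using u v assms by blast
  qed
qed

text \<open>The fractional parts of \<open>k ^ n * y\<close> are pairwise distinct, since a
  coincidence would make \<open>y\<close> rational; they form an infinite subset of a compact
  interval.\<close>

lemma irrational_small_differences:
  assumes A: "one_periodic A" "times_invariant k A" and k: "k \<ge> 2" and y: "y \<in> A" "y \<notin> \<rat>"
  shows "small_differences A"
proof -
  define f where "f n = frac (real (k ^ n) * y)" for n
  have inj: "inj f"
  proof (rule injI)
    fix m n assume "f m = f n"
    then have eq: "(real (k ^ m) - real (k ^ n)) * y = of_int (\<lfloor>real (k ^ m) * y\<rfloor> - \<lfloor>real (k ^ n) * y\<rfloor>)"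
      by (simp add: f_def frac_def algebra_simps)
    show "m = n"
    proof (rule ccontr)
      assume "m \<noteq> n"
      then have "k ^ m \<noteq> k ^ n" using k by simp
      then have ne: "real (k ^ m) - real (k ^ n) \<noteq> 0" by (metis eq_iff_diff_eq_0 of_nat_eq_iff)
      have "y = of_int (\<lfloor>real (k ^ m) * y\<rfloor> - \<lfloor>real (k ^ n) * y\<rfloor>) / (real (k ^ m) - real (k ^ n))"
        using eq ne by (metis nonzero_mult_div_cancel_left)
      also have "\<dots> \<in> \<rat>" by simp
      finally show False using y by simp
    qed
  qed
  have "f n \<in> A" for n
  proof -
    have "real (k ^ n) * y \<in> A" using A y times_invariant_power times_invariantD by blast
    then have "real (k ^ n) * y + of_int (- \<lfloor>real (k ^ n) * y\<rfloor>) \<in> A" using A one_periodicD by blast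
    then show ?thesis by (simp add: f_def frac_def)
  qed
  moreover have "f n \<in> {0..1}" for n using frac_lt_1[of "real (k ^ n) * y"] by (simp add: f_def less_imp_le)
  ultimately show ?thesis
    using infinite_small_differences[of "range f" A] range_inj_infinite[OF inj] by blast
qed

lemma small_differences_limpt:
  assumes A: "one_periodic A" "small_differences A"
  obtains l where "l islimpt A"
proof -
  have "infinite (A \<inter> {0..2})"
  proof
    assume fin: "finite (A \<inter> {0..2})"
    define D where "D = (\<lambda>(u, v). \<bar>u - v\<bar>) ` ((A \<inter> {0..2}) \<times> (A \<inter> {0..2})) - {0::real}"
    have "finite D" unfolding D_def using fin by blast
    \<comment> \<open>Inserting 1 ensures \<open>e \<le> 1\<close>, so two points closer than
      \<open>e\<close> can be moved into \<open>{0..2}\<close> by the same integer.\<close>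
    define e where "e = Min (insert 1 D)"
    have "e > 0" "e \<le> 1" using \<open>finite D\<close> by (auto simp: e_def D_def)
    then obtain u v where uv: "u \<in> A" "v \<in> A" "u \<noteq> v" "\<bar>u - v\<bar> < e"
      using A(2) unfolding small_differences_def by blast
    define m where "m = - \<lfloor>min u v\<rfloor>"
    have "u + m \<in> A" "v + m \<in> A" using A uv one_periodicD by blast+
    moreover have "u + m \<in> {0..2}" "v + m \<in> {0..2}"
      using uv \<open>e \<le> 1\<close> unfolding m_def by (auto simp: min_def) linarith+
    ultimately have "\<bar>(u + m) - (v + m)\<bar> \<in> D" using uv unfolding D_def by (auto intro!: image_eqI[of _ _ "(u + m, v + m)"])
    then have "e \<le> \<bar>u - v\<bar>" unfolding e_def using \<open>finite D\<close> by (auto intro: Min_le)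
    then show False using uv by simp
  qed
  then obtain l where "l islimpt (A \<inter> {0..2})"
    by (metis compact_Icc compact_eq_Bolzano_Weierstrass inf_le2)
  then show ?thesis using that islimpt_subset by blast
qed

text \<open>The difference set of \<open>B\<close> inherits periodicity and invariance and has
  arbitrarily small nonzero elements, hence is everything.\<close>

lemma differences_UNIV:
  assumes B: "closed B" "one_periodic B" "times_invariant (2 ^ u) B" "times_invariant (3 ^ u) B"
    and u: "u > 0" and small: "small_differences B"
  obtains v where "v \<in> B" "v + y \<in> B"
proof -
  \<comment> \<open>Restricting \<open>t\<close> to a compact piece makes the difference set closed;
    by periodicity no difference is lost.\<close>
  define D where "D = (\<Union>s\<in>B. \<Union>t\<in>B \<inter> {0..1}. {s - t})"
  have D: "s - t \<in> D" if "s \<in> B" "t \<in> B" for s t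
  proof -
    have "s + of_int (- \<lfloor>t\<rfloor>) \<in> B" "t + of_int (- \<lfloor>t\<rfloor>) \<in> B" using that B one_periodicD by blast+
    moreover have "t + of_int (- \<lfloor>t\<rfloor>) \<in> {0..1}" by simp linarith
    ultimately have "(s + of_int (- \<lfloor>t\<rfloor>)) - (t + of_int (- \<lfloor>t\<rfloor>)) \<in> D" unfolding D_def by blast
    then show ?thesis by simp
  qed
  have D': "\<exists>s\<in>B. \<exists>t\<in>B. x = s - t" if "x \<in> D" for x using that unfolding D_def by blast
  have inv: "times_invariant k D" if "times_invariant k B" for k
    unfolding times_invariant_def
  proof
    fix x assume "x \<in> D"
    then obtain s t where st: "s \<in> B" "t \<in> B" "x = s - t" using D' by blast
    then have "real k * s - real k * t \<in> D" using D that times_invariantD by blast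
    then show "real k * x \<in> D" using st by (simp add: right_diff_distrib)
  qed
  have "D = UNIV"
  proof (rule UNIV_if_small_elements[OF _ _ _ _ u])
    have "compact (B \<inter> {0..1})" using B by (simp add: closed_Int_compact)
    then show "closed D" unfolding D_def using B closed_compact_differences by blast
    show "one_periodic D" unfolding one_periodic_def
    proof (intro ballI allI)
      fix x and m :: int assume "x \<in> D"
      then obtain s t where st: "s \<in> B" "t \<in> B" "x = s - t" using D' by blast
      then have "(s + of_int m) - t \<in> D" using D B one_periodicD by blast
      moreover have "x + of_int m = (s + of_int m) - t" using st by simp
      ultimately show "x + of_int m \<in> D" by metis
    qed
    show "times_invariant (2 ^ u) D" "times_invariant (3 ^ u) D" using inv B by auto
    fix \<epsilon> :: real assume "\<epsilon> > 0"
    then obtain s t where "s \<in> B" "t \<in> B" "s \<noteq> t" "\<bar>s - t\<bar> < \<epsilon>" using small unfolding small_differences_def by blast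
    then show "\<exists>x\<in>D. x \<noteq> 0 \<and> \<bar>x\<bar> < \<epsilon>" using D by (intro bexI[of _ "s - t"]) auto
  qed
  then have "y \<in> D" by simp
  then obtain s t where "s \<in> B" "t \<in> B" "y = s - t" using D' by blast
  then show ?thesis using that[of t] by simp
qed

text \<open>If \<open>A\<close> is not everything, its derived set \<open>A'\<close> contains no
  rational. Yet \<open>A'\<close> contains arbitrarily long progressions with step
  \<open>1 / t\<close>, hence points arbitrarily close to 0 modulo 1, and being closed it contains
  0.\<close>

theorem Furstenberg_times_2_times_3:
  assumes A: "closed A" "one_periodic A" "times_invariant 2 A" "times_invariant 3 A"
    and small: "small_differences A"
  shows "A = UNIV"
proof (rule ccontr)
  assume nU: "A \<noteq> UNIV"
  define A' where "A' = {x. x islimpt A}"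
  have irr: "x \<notin> \<rat>" if "x \<in> A'" for x using UNIV_if_rational_limpt[OF A] nU that unfolding A'_def by blast
  have A': "closed A'" "one_periodic A'" "times_invariant 2 A'" "times_invariant 3 A'"
    unfolding A'_def using A by (auto intro: closed_limpts one_periodic_limpt times_invariant_limpt)
  obtain l where l: "l \<in> A'" using small_differences_limpt[OF A(2) small] unfolding A'_def by blast
  \<comment> \<open>The form \<open>6 * k + 1\<close> makes \<open>t\<close> coprime to 6 and
    arbitrarily large.\<close>
  have dense: "\<exists>x. \<forall>i::nat\<le>n. x + i / t \<in> A'" if t: "t = 6 * k + 1" "k > 0" for t k n :: nat
  proof (induction n)
    case 0
    then show ?case using l by auto
  next
    case (Suc n)
    \<comment> \<open>The starting points of progressions with \<open>n + 1\<close> terms in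
      \<open>A'\<close>. Two starting points at distance \<open>1 / t\<close> give a progression
      with one more term, so it suffices that the differences of \<open>B\<close> exhaust the
      reals.\<close>
    define B where "B = {x. \<forall>i::nat\<le>n. x + i / t \<in> A'}"
    have "coprime t 6"
    proof (rule coprimeI)
      fix d assume "d dvd t" "d dvd 6"
      then show "is_unit d" unfolding t using dvd_add_right_iff[of d "6 * k" 1] by simp
    qed
    then obtain u where u: "u > 0" "int t dvd 2 ^ u - 1" "int t dvd 3 ^ u - 1" using coprime_6_exponent by blast
    \<comment> \<open>Since \<open>m ^ u\<close> is 1 modulo \<open>t\<close>, multiplication by it
      changes each offset \<open>i / t\<close> only by an integer.\<close>
    have inv: "times_invariant (m ^ u) B" if m: "int t dvd int m ^ u - 1" "times_invariant m A'" for m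
      unfolding times_invariant_def B_def
    proof safe
      fix x and i :: nat assume x: "\<forall>i::nat\<le>n. x + i / t \<in> A'" and i: "i \<le> n"
      obtain w where "int m ^ u - 1 = int t * w" using m by blast
      then have "real_of_int (int m ^ u - 1) = real_of_int (int t * w)" by simp
      then have eq: "real (m ^ u) = 1 + t * of_int w" by simp
      have "real (m ^ u) * (x + i / t) + of_int (- (int i * w)) \<in> A'"
        using x i m A' one_periodicD times_invariantD times_invariant_power by blast
      also have "real (m ^ u) * (x + i / t) + of_int (- (int i * w)) = real (m ^ u) * x + i / t"
        using t unfolding distrib_left eq by (simp add: field_simps)
      finally show "real (m ^ u) * x + i / t \<in> A'" .
    qed
    have "closed B"
    proof -
      have "B = (\<Inter>i\<in>{..n}. (\<lambda>x. x + real i / t) -` A')" by (auto simp: B_def)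
      also have "closed \<dots>" using A'(1) by (intro closed_INT ballI closed_vimage) (auto intro!: continuous_intros)
      finally show ?thesis .
    qed
    have Bper: "one_periodic B" unfolding one_periodic_def B_def
    proof safe
      fix x and m :: int and i :: nat assume "\<forall>i::nat\<le>n. x + i / t \<in> A'" "i \<le> n"
      then have "x + i / t + of_int m \<in> A'" using A' one_periodicD by blast
      then show "x + of_int m + i / t \<in> A'" by (simp add: algebra_simps)
    qed
    have Binv: "times_invariant (2 ^ u) B" "times_invariant (3 ^ u) B" using inv[of 2] inv[of 3] u A' by auto
    obtain x where x: "x \<in> B" using Suc by (auto simp: B_def)
    then have "x + (0::nat) / t \<in> A'" unfolding B_def by blast
    then have "x \<notin> \<rat>" using irr by simp
    moreover have "(2::nat) ^ u \<ge> 2" using u self_le_power[of "2::nat" u] by simp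
    ultimately have "small_differences B" using irrational_small_differences[OF Bper Binv(1)] x by blast
    then obtain v where v: "v \<in> B" "v + 1 / t \<in> B" using differences_UNIV[OF \<open>closed B\<close> Bper Binv u(1)] by blast
    have "v + i / t \<in> A'" if "i \<le> Suc n" for i :: nat
    proof (cases i)
      case 0 then show ?thesis using v unfolding B_def by auto
    next
      case (Suc j)
      then have "j \<le> n" using that by simp
      then have "v + 1 / t + j / t \<in> A'" using v(2) unfolding B_def by simp
      then show ?thesis using Suc by (simp add: add_divide_distrib algebra_simps)
    qed
    then show ?case by blast
  qed
  have "0 \<in> closure A'"
    unfolding closure_approachable
  proof (intro allI impI)
    fix e :: real assume e: "e > 0"
    obtain k :: nat where k: "k > 0" "1 / e < k"
      by (metis e gr0I less_numeral_extra(3) of_nat_0 order_less_trans reals_Archimedean2 zero_less_divide_1_iff)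
    define t where "t = 6 * k + 1"
    have t: "t > 0" "1 / t < e" using k e by (auto simp: t_def field_simps)
    obtain x where x: "\<And>i::nat. i \<le> t \<Longrightarrow> x + i / t \<in> A'" using dense[OF t_def k(1), of t] by blast
    \<comment> \<open>With this \<open>N\<close> the point \<open>x + N / t\<close> lies in
      \<open>[0, 1 / t)\<close>. Division of \<open>N\<close> by \<open>t\<close> shows that it is
      an integer translate of the \<open>i\<close>-th term of the progression.\<close>
    define N where "N = - \<lfloor>t * x\<rfloor>"
    define i where "i = nat (N mod int t)"
    define w where "w = N div int t"
    have i: "int i = N mod int t" "i \<le> t" using t by (auto simp: i_def nat_le_iff order.strict_implies_order)
    then have "int t * w + int i = N" by (simp add: w_def)
    then have "real_of_int (int t * w + int i) = N" by (rule arg_cong)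
    then have "real t * of_int w + i = N" by simp
    then have eq: "N / t = of_int w + i / t" using t by (simp add: field_simps)
    have "x + i / t + of_int w \<in> A'" using x i A' one_periodicD by blast
    then have "x + N / t \<in> A'" using eq by (simp add: algebra_simps)
    moreover have "0 \<le> t * x + N" "t * x + N < 1" unfolding N_def by linarith+
    then have "0 \<le> (t * x + N) / t" "(t * x + N) / t < 1 / t" using t by (simp_all add: divide_strict_right_mono)
    moreover have "(t * x + N) / t = x + N / t" using t by (simp add: field_simps)
    ultimately show "\<exists>y\<in>A'. dist y 0 < e" using t by (intro bexI[of _ "x + N / t"]) auto
  qed
  then have "0 \<in> A'" using A' by (simp add: closure_closed)
  then show False using irr[of 0] by simp
qed


text \<open>The rows \<open>{2 ^ i * 3 ^ j * x | i \<ge> N j}\<close> may start arbitrarily late: every limit point of the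
  doubling orbit of \<open>x\<close> has its whole \<open>\<times>2\<times>3\<close> orbit in the closure of the rows.\<close>

theorem tails_times_2_times_3_dense:
  fixes x a b :: real and N :: "nat \<Rightarrow> nat"
  assumes x: "x \<notin> \<rat>" and ab: "a < b"
  shows "\<exists>i j. \<exists>m::int. i \<ge> N j \<and> a < 2 ^ i * 3 ^ j * x + m \<and> 2 ^ i * 3 ^ j * x + m < b"
proof (rule ccontr)
  assume neg: "\<not> ?thesis"
  then have avoid: "\<not> (a < 2 ^ i * 3 ^ j * x + of_int m \<and> 2 ^ i * 3 ^ j * x + of_int m < b)" if "i \<ge> N j" for i j and m :: int
    using neg that by blast
  \<comment> \<open>The points whose whole orbit under multiplication by 2 and 3 avoids the open
    interval modulo 1.\<close>
  define F where "F = {y. \<forall>i j. \<forall>m::int. 2 ^ i * 3 ^ j * y + of_int m \<le> a \<or> b \<le> 2 ^ i * 3 ^ j * y + of_int m}"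
  have FD: "2 ^ i * 3 ^ j * y + of_int m \<le> a \<or> b \<le> 2 ^ i * 3 ^ j * y + of_int m" if "y \<in> F" for y i j and m :: int
    using that by (simp add: F_def)
  have "closed F" unfolding F_def
    by (intro closed_Collect_all closed_Collect_disj closed_Collect_le continuous_intros)
  have Fper: "one_periodic F" unfolding one_periodic_def
  proof safe
    fix y and m' :: int assume y: "y \<in> F"
    have "2 ^ i * 3 ^ j * (y + of_int m') + of_int m = 2 ^ i * 3 ^ j * y + of_int (2 ^ i * 3 ^ j * m' + m)" for i j and m :: int
      by (simp add: algebra_simps)
    then show "y + of_int m' \<in> F" using FD[OF y] unfolding F_def mem_Collect_eq by metis
  qed
  have F2: "times_invariant 2 F" unfolding times_invariant_def
  proof safe
    fix y assume y: "y \<in> F"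
    have "2 ^ i * 3 ^ j * (real 2 * y) = 2 ^ Suc i * 3 ^ j * y" for i j by simp
    then show "real 2 * y \<in> F" using FD[OF y] unfolding F_def mem_Collect_eq by metis
  qed
  have F3: "times_invariant 3 F" unfolding times_invariant_def
  proof safe
    fix y assume y: "y \<in> F"
    have "2 ^ i * 3 ^ j * (real 3 * y) = 2 ^ i * 3 ^ Suc j * y" for i j by simp
    then show "real 3 * y \<in> F" using FD[OF y] unfolding F_def mem_Collect_eq by metis
  qed
  \<comment> \<open>The midpoint shows that \<open>F\<close> is not everything, so by Furstenberg's
    theorem distinct points of \<open>F\<close> keep a distance of at least some
    \<open>e > 0\<close>.\<close>
  have "(a + b) / 2 \<notin> F" using FD[of "(a + b) / 2" 0 0 0] ab by auto
  then have nsd: "\<not> small_differences F"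
    using Furstenberg_times_2_times_3[OF \<open>closed F\<close> Fper F2 F3] by blast
  then obtain e where e: "e > 0" "\<And>u v. u \<in> F \<Longrightarrow> v \<in> F \<Longrightarrow> \<bar>u - v\<bar> < e \<Longrightarrow> u = v"
    unfolding small_differences_def by blast
  \<comment> \<open>The doubling orbit of \<open>x\<close> approaches \<open>F\<close>: otherwise
    infinitely many of its points stay \<open>e / 4\<close> away from \<open>F\<close>, while a
    limit point of their fractional parts lies in \<open>F\<close>.\<close>
  have "\<exists>M. \<forall>n\<ge>M. \<exists>w\<in>F. \<bar>2 ^ n * x - w\<bar> < e / 4"
  proof (rule ccontr)
    assume "\<not> ?thesis"
    then have "\<forall>k. \<exists>n\<ge>k. \<forall>w\<in>F. \<not> \<bar>2 ^ n * x - w\<bar> < e / 4" by blast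
    then obtain n where n: "\<And>k. n k \<ge> k" "\<And>k w. w \<in> F \<Longrightarrow> \<not> \<bar>2 ^ n k * x - w\<bar> < e / 4" by metis
    define s where "s k = frac (2 ^ n k * x)" for k
    have "s k \<in> {0..1}" for k using frac_lt_1[of "2 ^ n k * x"] by (simp add: s_def less_imp_le)
    then obtain l r where lr: "strict_mono r" "(s \<circ> r) \<longlonglongrightarrow> l"
      using seq_compactE[OF compact_imp_seq_compact[OF compact_Icc]] by metis
    have "l \<in> F"
    proof (rule ccontr)
      assume "l \<notin> F"
      then obtain i j and m :: int where ijm: "a < 2 ^ i * 3 ^ j * l + m" "2 ^ i * 3 ^ j * l + m < b"
        unfolding F_def by (auto simp: not_le)
      have lim: "(\<lambda>k. 2 ^ i * 3 ^ j * (s \<circ> r) k + m) \<longlonglongrightarrow> 2 ^ i * 3 ^ j * l + m"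
        using lr(2) by (intro tendsto_intros)
      \<comment> \<open>Requiring \<open>k \<ge> N j\<close> makes the exponent of 2 late enough for
        row \<open>j\<close> to avoid the interval.\<close>
      have "\<forall>\<^sub>F k in sequentially. a < 2 ^ i * 3 ^ j * (s \<circ> r) k + m \<and> 2 ^ i * 3 ^ j * (s \<circ> r) k + m < b \<and> k \<ge> N j"
        using order_tendstoD[OF lim] ijm eventually_ge_at_top by (intro eventually_conj) auto
      from eventually_happens'[OF _ this] obtain k where k: "a < 2 ^ i * 3 ^ j * (s \<circ> r) k + m" "2 ^ i * 3 ^ j * (s \<circ> r) k + m < b" "k \<ge> N j" by auto
      define h where "h = n (r k)"
      have "h \<ge> N j" using n(1)[of "r k"] seq_suble[OF lr(1), of k] k(3) by (simp add: h_def)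
      have "2 ^ i * 3 ^ j * (s \<circ> r) k + m = 2 ^ (i + h) * 3 ^ j * x + of_int (m - 2 ^ i * 3 ^ j * \<lfloor>2 ^ h * x\<rfloor>)"
        by (simp add: s_def h_def frac_def power_add algebra_simps)
      then show False using k avoid[of j "i + h"] \<open>h \<ge> N j\<close> by (metis trans_le_add2)
    qed
    have "\<forall>\<^sub>F k in sequentially. \<bar>(s \<circ> r) k - l\<bar> < e / 4"
      using tendstoD[OF lr(2), of "e / 4"] e(1) unfolding dist_real_def by simp
    from eventually_happens'[OF _ this] obtain k where "\<bar>(s \<circ> r) k - l\<bar> < e / 4" by auto
    then have "\<bar>2 ^ n (r k) * x - (l + of_int \<lfloor>2 ^ n (r k) * x\<rfloor>)\<bar> < e / 4"
      by (simp add: s_def frac_def algebra_simps)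
    then show False using n(2) one_periodicD[OF Fper \<open>l \<in> F\<close>] by blast
  qed
  then obtain M w where w: "\<And>n. n \<ge> M \<Longrightarrow> w n \<in> F" "\<And>n. n \<ge> M \<Longrightarrow> \<bar>2 ^ n * x - w n\<bar> < e / 4"
    by metis
  \<comment> \<open>Both sides lie in \<open>F\<close> at distance less than
    \<open>3 * e / 4\<close>, so the gap forces equality.\<close>
  have wSuc: "w (Suc n) = 2 * w n" if "n \<ge> M" for n
  proof -
    have "2 * w n \<in> F" using F2 w(1)[OF that] unfolding times_invariant_def by auto
    moreover have "\<bar>2 ^ n * x - w n\<bar> < e / 4" "\<bar>2 * (2 ^ n * x) - w (Suc n)\<bar> < e / 4"
      using w(2)[of n] w(2)[of "Suc n"] that by (simp_all add: mult.assoc)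
    then have "\<bar>w (Suc n) - 2 * w n\<bar> < e" by linarith
    ultimately show ?thesis using e(2) w(1)[of "Suc n"] that by simp
  qed
  have err: "2 ^ (M + k) * x - w (M + k) = 2 ^ k * (2 ^ M * x - w M)" for k
  proof (induction k)
    case (Suc k)
    then show ?case using wSuc[of "M + k"] by (simp add: algebra_simps)
  qed simp
  \<comment> \<open>The error doubles at each step and stays below \<open>e / 4\<close>, so it
    vanishes. Thus \<open>F\<close> contains an irrational point, which forces small
    differences.\<close>
  have "2 ^ M * x - w M = 0"
  proof (rule ccontr)
    assume ne: "2 ^ M * x - w M \<noteq> 0"
    obtain k where "(e / 4) / \<bar>2 ^ M * x - w M\<bar> < 2 ^ k" using real_arch_pow[of 2 "(e / 4) / \<bar>2 ^ M * x - w M\<bar>"] by auto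
    then have "e / 4 < 2 ^ k * \<bar>2 ^ M * x - w M\<bar>" using ne by (simp add: field_simps)
    also have "\<dots> = \<bar>2 ^ (M + k) * x - w (M + k)\<bar>" unfolding err by (simp add: abs_mult)
    also have "\<dots> < e / 4" using w(2) by simp
    finally show False .
  qed
  then have "2 ^ M * x \<in> F" using w(1)[of M] by simp
  moreover have "2 ^ M * x \<notin> \<rat>"
  proof
    assume "2 ^ M * x \<in> \<rat>"
    then have "2 ^ M * x / 2 ^ M \<in> \<rat>" by (intro Rats_divide) auto
    then show False using x by simp
  qed
  ultimately have "small_differences F" using irrational_small_differences[OF Fper F2, of "2 ^ M * x"] by simp
  then show False using nsd by simp
qed

section \<open>Random Lueroth orbits\<close>

text \<open>The product in the definition of the cut points is the length of the branch interval, so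
  \<open>z_plus\<close> and \<open>z_minus\<close> cut it at the relative positions \<open>c\<close>
  and \<open>1 - c\<close>.\<close>

lemma z_pred_minus_z:
  assumes "n \<ge> 2" shows "z (n - 1) - z n = z n * z (n - 1)" "z (n - 1) - z n > 0"
proof -
  have "real (n - 1) = real n - 1" "real n - 1 > 0" using assms by (auto simp: of_nat_diff)
  then show "z (n - 1) - z n = z n * z (n - 1)" "z (n - 1) - z n > 0"
    by (auto simp: z_def field_simps)
qed

lemma z_plus_eq:
  assumes "n \<ge> 2" shows "z_plus c n = z n + c * (z (n - 1) - z n)"
  using z_pred_minus_z(1)[OF assms] by (simp add: z_plus_def mult.assoc)

lemma z_minus_eq:
  assumes "n \<ge> 2" shows "z_minus c (n - 1) = z n + (1 - c) * (z (n - 1) - z n)"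
proof -
  have "n - 1 + 1 = n" using assms by simp
  then have "z_minus c (n - 1) = z (n - 1) - c * (z n * z (n - 1))"
    unfolding z_minus_def by (simp add: mult_ac)
  then have "z_minus c (n - 1) = z (n - 1) - c * (z (n - 1) - z n)"
    using z_pred_minus_z(1)[OF assms] by simp
  then show ?thesis by (simp only: left_diff_distrib mult_1)
qed

lemma ceiling_inverse_branch:
  assumes "n \<ge> 2" "y \<in> {z n..<z (n - 1)}" shows "\<lceil>1 / y\<rceil> = int n"
proof -
  have n: "real (n - 1) = real n - 1" "real n - 1 > 0" using assms by (auto simp: of_nat_diff)
  have y: "1 / n \<le> y" "y < 1 / (real n - 1)" using assms n by (auto simp: z_def)
  then have "y > 0" using n by (smt (verit) divide_pos_pos)
  then have "real n - 1 < 1 / y" "1 / y \<le> n" using y n by (auto simp: field_simps)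
  then show ?thesis by (intro ceiling_unique) auto
qed

lemma branch_unique:
  assumes "n \<ge> 2" "m \<ge> 2" "y \<in> {z n..<z (n - 1)}" "y \<in> {z m..<z (m - 1)}" shows "n = m"
  using ceiling_inverse_branch assms by (metis of_nat_eq_iff)

text \<open>The second equation identifies \<open>T_L y\<close> with the relative position of
  \<open>y\<close> in its branch interval; membership in the various regions thereby becomes an
  inequality for \<open>T_L y\<close>.\<close>

lemma T_L_branch:
  assumes "n \<ge> 2" "y \<in> {z n..<z (n - 1)}"
  shows "T_L y = real (n * (n - 1)) * y - real (n - 1)" "y = z n + T_L y * (z (n - 1) - z n)"
proof -
  have n: "real (n - 1) = real n - 1" "real n - 1 > 0" using assms by (auto simp: of_nat_diff)
  have "z n > 0" using assms by (simp add: z_def)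
  then have "y > 0" using assms by auto
  have "z (n - 1) \<le> 1" using assms by (simp add: z_def)
  then have "y < 1" using assms by auto
  then show eq: "T_L y = real (n * (n - 1)) * y - real (n - 1)"
    using \<open>y > 0\<close> ceiling_inverse_branch[OF assms] n by (simp add: T_L_def)
  show "y = z n + T_L y * (z (n - 1) - z n)"
    unfolding eq z_pred_minus_z(1)[OF assms(1)] using n by (simp add: z_def field_simps)
qed

lemma branch_exists:
  assumes "0 < y" "y < 1"
  obtains n where "n \<ge> 2" "y \<in> {z n..<z (n - 1)}"
proof -
  define n where "n = nat \<lceil>1 / y\<rceil>"
  have "1 / y > 1" using assms by simp
  then have "\<lceil>1 / y\<rceil> \<ge> 2" by (simp add: le_ceiling_iff)
  then have n: "real n = of_int \<lceil>1 / y\<rceil>" "n \<ge> 2" unfolding n_def by linarith+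
  then have "1 / y \<le> n" "real n - 1 < 1 / y" by linarith+
  then have "1 \<le> n * y" "(real n - 1) * y < 1"
    using assms by (simp_all only: pos_divide_le_eq pos_less_divide_eq)
  moreover have "real (n - 1) = real n - 1" using n by (simp add: of_nat_diff)
  ultimately have "y \<in> {z n..<z (n - 1)}" using assms n by (auto simp: z_def field_simps)
  with n that show ?thesis by blast
qed

text \<open>Each interval of the union lies inside its own branch interval, so only the index
  \<open>n\<close> can contribute.\<close>

lemma in_T0_region_iff:
  assumes c: "c \<le> 1/2" and n: "n \<ge> 2" "y \<in> {z n..<z (n - 1)}"
  shows "y \<in> (\<Union>m\<in>{2..}. {z m..<z_plus c m}) \<longleftrightarrow> T_L y < c"
proof -
  have h: "z (n - 1) - z n > 0" by (rule z_pred_minus_z[OF n(1)])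
  obtain t where t: "T_L y = t" "y = z n + t * (z (n - 1) - z n)" using T_L_branch(2)[OF n] by blast
  have "y \<in> {z n..<z_plus c n} \<longleftrightarrow> t * (z (n - 1) - z n) < c * (z (n - 1) - z n)"
    using t(2) n unfolding z_plus_eq[OF n(1)] by auto
  then have iff: "y \<in> {z n..<z_plus c n} \<longleftrightarrow> T_L y < c" using h t(1) by simp
  have uniq: "m = n" if m: "m \<ge> 2" "y \<in> {z m..<z_plus c m}" for m
  proof -
    have "c * (z (m - 1) - z m) \<le> 1 * (z (m - 1) - z m)"
      using c z_pred_minus_z(2)[OF m(1)] by (intro mult_right_mono) auto
    then have "z_plus c m \<le> z (m - 1)" unfolding z_plus_eq[OF m(1)] by simp
    then show ?thesis using branch_unique[OF m(1) n(1) _ n(2)] m(2) by auto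
  qed
  have "y \<in> (\<Union>m\<in>{2..}. {z m..<z_plus c m}) \<longleftrightarrow> y \<in> {z n..<z_plus c n}"
    unfolding UN_iff Bex_def atLeast_iff using uniq n(1) by blast
  then show ?thesis using iff by blast
qed

lemma in_T1_region_iff:
  assumes c: "0 < c" and n: "n \<ge> 2" "y \<in> {z n..<z (n - 1)}"
  shows "y \<in> (\<Union>m\<in>{2..}. {z m..z_minus c (m - 1)}) \<longleftrightarrow> T_L y \<le> 1 - c"
proof -
  have h: "z (n - 1) - z n > 0" by (rule z_pred_minus_z[OF n(1)])
  obtain t where t: "T_L y = t" "y = z n + t * (z (n - 1) - z n)" using T_L_branch(2)[OF n] by blast
  have "y \<in> {z n..z_minus c (n - 1)} \<longleftrightarrow> t * (z (n - 1) - z n) \<le> (1 - c) * (z (n - 1) - z n)"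
    using t(2) n unfolding z_minus_eq[OF n(1)] by auto
  then have iff: "y \<in> {z n..z_minus c (n - 1)} \<longleftrightarrow> T_L y \<le> 1 - c" using h t(1) by simp
  have uniq: "m = n" if m: "m \<ge> 2" "y \<in> {z m..z_minus c (m - 1)}" for m
  proof -
    \<comment> \<open>The interval is closed on the right, so a strict inequality is needed to stay
      inside the half-open branch.\<close>
    have "(1 - c) * (z (m - 1) - z m) < 1 * (z (m - 1) - z m)"
      using c z_pred_minus_z(2)[OF m(1)] by (intro mult_strict_right_mono) auto
    then have "z_minus c (m - 1) < z (m - 1)" unfolding z_minus_eq[OF m(1)] by simp
    then show ?thesis using branch_unique[OF m(1) n(1) _ n(2)] m(2) by auto
  qed
  have "y \<in> (\<Union>m\<in>{2..}. {z m..z_minus c (m - 1)}) \<longleftrightarrow> y \<in> {z n..z_minus c (n - 1)}"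
    unfolding UN_iff Bex_def atLeast_iff using uniq n(1) by blast
  then show ?thesis using iff by blast
qed

lemma in_switch_region_iff:
  assumes c: "0 < c" "c \<le> 1/2" and n: "n \<ge> 2" "y \<in> {z n..<z (n - 1)}" and y: "y \<in> {c..1}"
  shows "y \<in> switch_region c \<longleftrightarrow> c \<le> T_L y \<and> T_L y \<le> 1 - c"
proof -
  have h: "z (n - 1) - z n > 0" by (rule z_pred_minus_z[OF n(1)])
  obtain t where t: "T_L y = t" "y = z n + t * (z (n - 1) - z n)" using T_L_branch(2)[OF n] by blast
  have "y \<in> {z_plus c n..z_minus c (n - 1)} \<longleftrightarrow> c * (z (n - 1) - z n) \<le> t * (z (n - 1) - z n) \<and>
      t * (z (n - 1) - z n) \<le> (1 - c) * (z (n - 1) - z n)"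
    using t(2) unfolding z_minus_eq[OF n(1)] z_plus_eq[OF n(1)] by auto
  then have iff: "y \<in> {z_plus c n..z_minus c (n - 1)} \<longleftrightarrow> c \<le> T_L y \<and> T_L y \<le> 1 - c" using h t(1) by simp
  have uniq: "m = n" if m: "m \<ge> 2" "y \<in> {z_plus c m..z_minus c (m - 1)}" for m
  proof -
    have hm: "z (m - 1) - z m > 0" by (rule z_pred_minus_z[OF m(1)])
    have "(1 - c) * (z (m - 1) - z m) < 1 * (z (m - 1) - z m)"
      using c hm by (intro mult_strict_right_mono) auto
    then have "z_minus c (m - 1) < z (m - 1)" unfolding z_minus_eq[OF m(1)] by simp
    moreover have "z m \<le> z_plus c m" unfolding z_plus_eq[OF m(1)] using c hm by simp
    ultimately show ?thesis using branch_unique[OF m(1) n(1) _ n(2)] m(2) by auto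
  qed
  have "y \<in> (\<Union>m\<in>{2..}. {z_plus c m..z_minus c (m - 1)}) \<longleftrightarrow> y \<in> {z_plus c n..z_minus c (n - 1)}"
    unfolding UN_iff Bex_def atLeast_iff using uniq n(1) by blast
  then show ?thesis using iff y unfolding switch_region_def by blast
qed

lemma in_upper_region_iff:
  assumes c: "0 < c" "c \<le> 1/2" and n: "n \<ge> 2" "y \<in> {z n..<z (n - 1)}"
  shows "y \<in> (\<Union>m\<in>{1..}. {z_minus c m<..<z m}) \<longleftrightarrow> 1 - c < T_L y"
proof -
  have h: "z (n - 1) - z n > 0" by (rule z_pred_minus_z[OF n(1)])
  obtain t where t: "T_L y = t" "y = z n + t * (z (n - 1) - z n)" using T_L_branch(2)[OF n] by blast
  have "y \<in> {z_minus c (n - 1)<..<z (n - 1)} \<longleftrightarrow> (1 - c) * (z (n - 1) - z n) < t * (z (n - 1) - z n)"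
    using t(2) n unfolding z_minus_eq[OF n(1)] by auto
  then have iff: "y \<in> {z_minus c (n - 1)<..<z (n - 1)} \<longleftrightarrow> 1 - c < T_L y" using h t(1) by simp
  have uniq: "m = n - 1" if m: "m \<ge> 1" "y \<in> {z_minus c m<..<z m}" for m
  proof -
    \<comment> \<open>This union is indexed by the right endpoint \<open>z m\<close>, which belongs
      to branch \<open>Suc m\<close>.\<close>
    have m2: "Suc m \<ge> 2" using m by simp
    have "0 \<le> (1 - c) * (z (Suc m - 1) - z (Suc m))"
      using c z_pred_minus_z(2)[OF m2] by (intro mult_nonneg_nonneg) auto
    then have "z (Suc m) \<le> z_minus c m" using z_minus_eq[OF m2, of c] by simp
    then show ?thesis using branch_unique[OF m2 n(1) _ n(2)] m(2) by auto
  qed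
  have n1: "n - 1 \<ge> 1" using n(1) by simp
  have "y \<in> (\<Union>m\<in>{1..}. {z_minus c m<..<z m}) \<longleftrightarrow> y \<in> {z_minus c (n - 1)<..<z (n - 1)}"
    unfolding UN_iff Bex_def atLeast_iff using uniq n1 by blast
  then show ?thesis using iff by blast
qed

section \<open>The random map on irrational points\<close>

definition step :: "real \<Rightarrow> nat \<Rightarrow> real \<Rightarrow> real" where
  "step c b y = (if b = 0 then T0 c y else T1 c y)"

definition irrationals_from :: "real \<Rightarrow> real set" where
  "irrationals_from c = {c..1} - \<rat>"

lemma irrationals_from_branch:
  assumes "0 < c" "y \<in> irrationals_from c"
  obtains n where "n \<ge> 2" "y \<in> {z n..<z (n - 1)}"
proof -
  have "y \<noteq> 1" using assms by (auto simp: irrationals_from_def)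
  then show ?thesis using branch_exists[of y] that assms by (auto simp: irrationals_from_def)
qed

text \<open>On each branch \<open>y\<close> is an affine function of \<open>T_L y\<close> with
  rational coefficients.\<close>

lemma T_L_irrational:
  assumes "0 < c" "y \<in> irrationals_from c"
  shows "T_L y \<notin> \<rat>" "0 < T_L y" "T_L y < 1"
proof -
  obtain n where n: "n \<ge> 2" "y \<in> {z n..<z (n - 1)}" by (rule irrationals_from_branch[OF assms])
  have eq: "y = z n + T_L y * (z (n - 1) - z n)" by (rule T_L_branch[OF n])
  have zr: "z k \<in> \<rat>" for k by (simp add: z_def)
  show nr: "T_L y \<notin> \<rat>"
  proof
    assume "T_L y \<in> \<rat>"
    then have "z n + T_L y * (z (n - 1) - z n) \<in> \<rat>" using zr by (intro Rats_add Rats_mult Rats_diff)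
    then show False using eq assms by (simp add: irrationals_from_def)
  qed
  have h: "z (n - 1) - z n > 0" by (rule z_pred_minus_z[OF n(1)])
  have "z n \<le> y" "y < z (n - 1)" using n(2) by auto
  then have "0 \<le> T_L y * (z (n - 1) - z n)" "T_L y * (z (n - 1) - z n) < 1 * (z (n - 1) - z n)"
    using eq unfolding mult_1 by linarith+
  then have "0 \<le> T_L y" "T_L y < 1" using h by (simp_all only: zero_le_mult_iff mult_less_cancel_right_pos) auto
  moreover have "T_L y \<noteq> 0" using nr by auto
  ultimately show "0 < T_L y" "T_L y < 1" by auto
qed

text \<open>Outside the switch region \<open>T0\<close> and \<open>T1\<close> agree;
  \<open>c \<le> 1/2\<close> makes the first two cases exclusive.\<close>

lemma step_eq:
  assumes "0 < c" "c \<le> 1/2" "y \<in> irrationals_from c"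
  shows "step c b y = (if T_L y < c then 1 - T_L y else if 1 - c < T_L y then T_L y
    else if b = 0 then T_L y else 1 - T_L y)"
proof -
  obtain n where n: "n \<ge> 2" "y \<in> {z n..<z (n - 1)}" by (rule irrationals_from_branch[OF assms(1,3)])
  show ?thesis
    using in_T0_region_iff[OF assms(2) n] in_T1_region_iff[OF assms(1) n] assms
    unfolding step_def T0_def T1_def T_A_def by auto
qed

lemma sign_digit_eq:
  assumes "0 < c" "c \<le> 1/2" "y \<in> irrationals_from c"
  shows "sign_digit c (\<omega>, y) = (if T_L y < c then 1 else if 1 - c < T_L y then 0 else \<omega> 0)"
proof -
  obtain n where n: "n \<ge> 2" "y \<in> {z n..<z (n - 1)}" by (rule irrationals_from_branch[OF assms(1,3)])
  have y: "y \<in> {c..1}" "y \<noteq> 1" using assms by (auto simp: irrationals_from_def)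
  show ?thesis
    using in_switch_region_iff[OF assms(1,2) n y(1)] in_upper_region_iff[OF assms(1,2) n] y assms
    unfolding sign_digit_def by auto
qed

lemma Lueroth_digit_eq:
  assumes "n \<ge> 2" "y \<in> {z n..<z (n - 1)}"
  shows "Lueroth_digit (\<omega>, y) = n"
proof -
  have "z (n - 1) \<le> 1" using assms by (simp add: z_def)
  then have "y \<noteq> 1" using assms by auto
  moreover have "(THE n. n \<ge> 2 \<and> y \<in> {z n..<z (n - 1)}) = n"
    using assms branch_unique by (intro the_equality) blast+
  ultimately show ?thesis by (simp add: Lueroth_digit_def)
qed

lemma step_irrationals_from:
  assumes "0 < c" "c \<le> 1/2" "y \<in> irrationals_from c"
  shows "step c b y \<in> irrationals_from c"
proof -
  have t: "T_L y \<notin> \<rat>" "0 < T_L y" "T_L y < 1" using T_L_irrational assms by blast+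
  have "1 - T_L y \<notin> \<rat>" using t(1) Rats_diff[of 1 "1 - T_L y"] by auto
  then show ?thesis using t assms unfolding step_eq[OF assms] irrationals_from_def by auto
qed

text \<open>Either of \<open>T_L y\<close> and \<open>1 - T_L y\<close> can be chosen as soon as it
  is at least \<open>c\<close>, and the digit used is then also the sign in the expansion.\<close>

lemma step_select:
  assumes "0 < c" "c \<le> 1/2" "y \<in> irrationals_from c"
    and "s \<in> {0, 1}" "c \<le> (if s = 0 then T_L y else 1 - T_L y)" "\<omega> 0 = s"
  shows "step c s y = (if s = 0 then T_L y else 1 - T_L y)" "sign_digit c (\<omega>, y) = s"
  using assms unfolding step_eq[OF assms(1-3)] sign_digit_eq[OF assms(1-3)] by auto

primrec orbit :: "real \<Rightarrow> (nat \<Rightarrow> nat) \<Rightarrow> real \<Rightarrow> nat \<Rightarrow> real" where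
  "orbit c \<omega> x 0 = x"
| "orbit c \<omega> x (Suc n) = step c (\<omega> n) (orbit c \<omega> x n)"

lemma random_Lueroth_funpow:
  "(random_Lueroth c p ^^ n) (\<omega>, x) = ((\<lambda>j. \<omega> (n + j)), orbit c \<omega> x n)"
  by (induction n) (auto simp: random_Lueroth_def shift_def step_def)

lemma sign_digit_cong: "\<omega> 0 = \<omega>' 0 \<Longrightarrow> sign_digit c (\<omega>, y) = sign_digit c (\<omega>', y)"
  by (simp add: sign_digit_def)

text \<open>The digits depend on a sequence only through its first entry, so a constant sequence can
  replace the shifted one.\<close>

lemma Lueroth_expansion_eq:
  "Lueroth_expansion c p \<omega> x n =
    (sign_digit c (\<lambda>_. \<omega> n, orbit c \<omega> x n), Lueroth_digit (\<lambda>_. \<omega> n, orbit c \<omega> x n))"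
  unfolding Lueroth_expansion_def random_Lueroth_funpow Let_def
  by (auto intro!: sign_digit_cong simp: Lueroth_digit_def)

lemma orbit_irrationals_from:
  assumes "0 < c" "c \<le> 1/2" "x \<in> irrationals_from c"
  shows "orbit c \<omega> x n \<in> irrationals_from c"
  using assms by (induction n) (auto intro: step_irrationals_from)

lemma orbit_cong:
  assumes "\<And>i. i < n \<Longrightarrow> \<omega> i = \<omega>' i" shows "orbit c \<omega> x n = orbit c \<omega>' x n"
  using assms by (induction n) auto

lemma orbit_fold_step:
  assumes "\<And>i. i < length w \<Longrightarrow> \<omega> (n + i) = w ! i"
  shows "orbit c \<omega> x (n + length w) = fold (step c) w (orbit c \<omega> x n)"
  using assms
proof (induction w rule: rev_induct)
  case (snoc b w)
  have "\<omega> (n + i) = w ! i" if "i < length w" for i using snoc.prems[of i] that by (simp add: nth_append)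
  then have "orbit c \<omega> x (n + length w) = fold (step c) w (orbit c \<omega> x n)" by (rule snoc.IH)
  moreover have "\<omega> (n + length w) = b" using snoc.prems[of "length w"] by simp
  ultimately show ?case by simp
qed simp

section \<open>Visits to the switch region\<close>

lemma doubling_unbounded:
  fixes e :: "nat \<Rightarrow> real"
  assumes "e 0 \<noteq> 0" "\<And>k. \<bar>e (Suc k)\<bar> = 2 * \<bar>e k\<bar>" "\<And>k. \<bar>e k\<bar> \<le> B"
  shows False
proof -
  have eq: "\<bar>e k\<bar> = 2 ^ k * \<bar>e 0\<bar>" for k by (induction k) (auto simp: assms(2))
  obtain k where "B / \<bar>e 0\<bar> < 2 ^ k" using real_arch_pow[of 2 "B / \<bar>e 0\<bar>"] by auto
  then have "B < 2 ^ k * \<bar>e 0\<bar>" using assms(1) by (simp add: field_simps)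
  then show False using eq[of k] assms(3)[of k] by simp
qed

text \<open>An orbit avoiding the switch region ends up in \<open>(1 - c, 1)\<close>, where \<open>u = 1 - y\<close> first moves
  by \<open>u \<mapsto> 2u\<close> and then by \<open>u \<mapsto> 1 - 2u\<close>, which repels from its rational fixed point \<open>1/3\<close>.\<close>

lemma orbit_hits_switch_region:
  assumes c: "0 < c" "c \<le> 2/5" and x: "x \<in> irrationals_from c"
  shows "\<exists>m\<ge>n. orbit c \<omega> x m \<in> switch_region c"
proof (rule ccontr)
  assume "\<not> ?thesis"
  then have avoid: "orbit c \<omega> x m \<notin> switch_region c" if "m \<ge> n" for m using that by blast
  have c2: "c \<le> 1/2" using c by simp
  define u where "u m = 1 - orbit c \<omega> x m" for m
  note irr = orbit_irrationals_from[OF c(1) c2 x]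
  have out: "T_L (orbit c \<omega> x m) < c \<or> 1 - c < T_L (orbit c \<omega> x m)" if m: "m \<ge> n" for m
  proof -
    obtain k where k: "k \<ge> 2" "orbit c \<omega> x m \<in> {z k..<z (k - 1)}" using irrationals_from_branch[OF c(1) irr] by blast
    have "orbit c \<omega> x m \<in> {c..1}" using irr by (auto simp: irrationals_from_def)
    then show ?thesis using in_switch_region_iff[OF c(1) c2 k] avoid[OF m] by auto
  qed
  \<comment> \<open>Outside the switch region the selected value always exceeds
    \<open>1 - c\<close>, whatever the digit.\<close>
  have small: "0 < u m" "u m < c" "u m \<notin> \<rat>" if m: "m > n" for m
  proof -
    obtain k where k: "m = Suc k" "k \<ge> n" using m by (metis less_eq_Suc_le Suc_le_D Suc_le_mono)
    show "u m < c" using out[OF k(2)] unfolding u_def k(1) orbit.simps step_eq[OF c(1) c2 irr] by auto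
    have "orbit c \<omega> x m \<in> {c..1} - \<rat>" using irr by (auto simp: irrationals_from_def)
    then show "u m \<notin> \<rat>" "0 < u m" using Rats_diff[of 1 "u m"] by (auto simp: u_def less_le)
  qed
  have dyn: "((1 - c) / 2 < u m \<and> u (Suc m) = 1 - 2 * u m) \<or> (u m < c / 2 \<and> u (Suc m) = 2 * u m)"
    if m: "m > n" for m
  proof -
    \<comment> \<open>As \<open>u m < c < 1/2\<close>, the point lies in branch 2.\<close>
    have "T_L (orbit c \<omega> x m) = 1 - 2 * u m"
      using T_L_branch(1)[of 2 "orbit c \<omega> x m"] small(1,2)[OF m] c by (simp add: u_def z_def)
    then show ?thesis
      using out[of m] m unfolding u_def orbit.simps step_eq[OF c(1) c2 irr] by (auto simp: u_def)
  qed
  have "\<exists>m>n. (1 - c) / 2 < u m"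
  proof (rule ccontr)
    assume neg: "\<not> ?thesis"
    then have no: "\<not> (1 - c) / 2 < u m" if "m > n" for m using that by blast
    have "\<bar>u (Suc n + Suc k)\<bar> = 2 * \<bar>u (Suc n + k)\<bar>" for k
      using dyn[of "Suc n + k"] no[of "Suc n + k"] by auto
    moreover have "\<bar>u (Suc n + k)\<bar> \<le> c" for k using small[of "Suc n + k"] by auto
    moreover have "u (Suc n + 0) \<noteq> 0" using small[of "Suc n + 0"] by auto
    ultimately show False using doubling_unbounded[of "\<lambda>k. u (Suc n + k)" c] by blast
  qed
  then obtain m where m: "m > n" "(1 - c) / 2 < u m" by blast
  \<comment> \<open>Here \<open>c \<le> 2/5\<close> enters: it gives
    \<open>1 - 2 * c \<ge> c / 2\<close>, so \<open>1 - 2 * u\<close> with \<open>u < c\<close>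
    cannot fall into the doubling range below \<open>c / 2\<close>.\<close>
  have stay: "(1 - c) / 2 < u (m + k)" for k
  proof (induction k)
    case 0
    then show ?case using m by simp
  next
    case (Suc k)
    then have "u (m + Suc k) = 1 - 2 * u (m + k)" using dyn[of "m + k"] m(1) c by auto
    then show ?case using small(2)[of "m + k"] dyn[of "m + Suc k"] m(1) c by auto
  qed
  have "\<bar>u (m + Suc k) - 1/3\<bar> = 2 * \<bar>u (m + k) - 1/3\<bar>" for k
  proof -
    have "u (m + Suc k) = 1 - 2 * u (m + k)" using dyn[of "m + k"] stay[of k] m(1) c by auto
    then have "u (m + Suc k) - 1/3 = - 2 * (u (m + k) - 1/3)" by simp
    then show ?thesis by (simp only: abs_mult)
  qed
  moreover have "\<bar>u (m + k) - 1/3\<bar> \<le> 1" for k using small(1,2)[of "m + k"] m(1) c by auto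
  moreover have "u (m + 0) - 1/3 \<noteq> 0"
  proof
    assume "u (m + 0) - 1/3 = 0"
    then have "u m = 1/3" by simp
    moreover have "1/3 \<in> (\<rat> :: real set)" by (intro Rats_divide) auto
    ultimately show False using small(3)[OF m(1)] by metis
  qed
  ultimately show False using doubling_unbounded[of "\<lambda>k. u (m + k) - 1/3" 1] by blast
qed

section \<open>Baire category on digit sequences\<close>

text \<open>States with cylinders that \<open>P\<close> has dense interior in the product topology
  on \<open>Omega\<close>.\<close>

definition dense_open :: "((nat \<Rightarrow> nat) \<Rightarrow> bool) \<Rightarrow> bool" where
  "dense_open P \<longleftrightarrow> (\<forall>\<omega>\<in>Omega. \<forall>n. \<exists>\<omega>'\<in>Omega. \<exists>n'. (\<forall>i<n. \<omega>' i = \<omega> i) \<and>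
     (\<forall>\<omega>''\<in>Omega. (\<forall>i<n'. \<omega>'' i = \<omega>' i) \<longrightarrow> P \<omega>''))"

text \<open>Nested cylinders are chosen, the \<open>k\<close>-th step securing the
  \<open>k\<close>-th condition; their common point is read off diagonally.\<close>

lemma Baire_Omega:
  assumes C: "countable C" "\<And>P. P \<in> C \<Longrightarrow> dense_open P"
  shows "\<exists>\<omega>\<in>Omega. \<forall>P\<in>C. P \<omega>"
proof (cases "C = {}")
  case True
  then show ?thesis by (intro bexI[of _ "\<lambda>_. 0"]) (auto simp: Omega_def)
next
  case False
  define P where "P = from_nat_into C"
  have P: "dense_open (P k)" for k unfolding P_def using C(2) from_nat_into[OF False] by blast
  define R where "R k f g \<longleftrightarrow> snd f < snd g \<and> (\<forall>i<snd f. fst g i = fst f i) \<and>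
     (\<forall>\<omega>\<in>Omega. (\<forall>i<snd g. \<omega> i = fst g i) \<longrightarrow> P k \<omega>)" for k :: nat and f g :: "(nat \<Rightarrow> nat) \<times> nat"
  have "\<exists>f. \<forall>k. fst (f k) \<in> Omega \<and> R k (f k) (f (Suc k))"
  proof (rule dependent_nat_choice)
    show "\<exists>f::(nat \<Rightarrow> nat) \<times> nat. fst f \<in> Omega" by (intro exI[of _ "(\<lambda>_. 0, 0)"]) (simp add: Omega_def)
    fix f :: "(nat \<Rightarrow> nat) \<times> nat" and k assume "fst f \<in> Omega"
    then obtain \<omega> n where "\<omega> \<in> Omega" "\<And>i. i < snd f \<Longrightarrow> \<omega> i = fst f i"
      "\<And>\<omega>'. \<omega>' \<in> Omega \<Longrightarrow> (\<forall>i<n. \<omega>' i = \<omega> i) \<Longrightarrow> P k \<omega>'"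
      using P[of k] unfolding dense_open_def by metis
    then show "\<exists>g. fst g \<in> Omega \<and> R k f g"
      \<comment> \<open>The maximum makes the cylinder lengths strictly increase, so that every
        coordinate is eventually fixed.\<close>
      by (intro exI[of _ "(\<omega>, max n (Suc (snd f)))"]) (auto simp: R_def)
  qed
  then obtain f where f: "\<And>k. fst (f k) \<in> Omega" "\<And>k. R k (f k) (f (Suc k))" by blast
  have snd_less: "snd (f k) < snd (f (Suc k))" for k using f(2) by (simp add: R_def)
  have mono: "snd (f k) \<le> snd (f k')" if "k \<le> k'" for k k'
    using that snd_less lift_Suc_mono_le[of "\<lambda>k. snd (f k)"] less_imp_le by blast
  have ge: "k \<le> snd (f k)" for k by (induction k) (use snd_less in \<open>auto intro: Suc_leI le_less_trans\<close>)
  have agree: "fst (f (k + d)) i = fst (f k) i" if i: "i < snd (f k)" for k d i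
  proof (induction d)
    case (Suc d)
    have "i < snd (f (k + d))" using mono[of k "k + d"] i by simp
    then show ?case using f(2)[of "k + d"] Suc by (simp add: R_def)
  qed simp
  \<comment> \<open>The cylinder with index \<open>Suc i\<close> has length at least
    \<open>i + 1\<close> and therefore fixes coordinate \<open>i\<close>.\<close>
  define \<omega> where "\<omega> i = fst (f (Suc i)) i" for i
  have eq: "\<omega> i = fst (f k) i" if "i < snd (f k)" for i k
  proof (cases "k \<le> Suc i")
    case True
    then show ?thesis using agree[OF that, of "Suc i - k"] by (simp add: \<omega>_def)
  next
    case False
    have "i < snd (f (Suc i))" using ge[of "Suc i"] by simp
    then show ?thesis using agree[of i "Suc i" "k - Suc i"] False by (simp add: \<omega>_def)
  qed
  have "\<omega> \<in> Omega" using f(1) unfolding Omega_def \<omega>_def by blast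
  moreover have "P k \<omega>" for k
  proof -
    have "\<forall>i<snd (f (Suc k)). \<omega> i = fst (f (Suc k)) i" using eq by blast
    then show ?thesis using f(2)[of k] \<open>\<omega> \<in> Omega\<close> unfolding R_def by blast
  qed
  ultimately show ?thesis unfolding P_def using from_nat_into_surj[OF C(1)] by metis
qed

text \<open>At a visit to the switch region after the given prefix, the sign digit is free and can
  be made to differ from that of \<open>a\<close>.\<close>

lemma dense_open_expansion_neq:
  assumes c: "0 < c" "c \<le> 2/5" and x: "x \<in> irrationals_from c"
  shows "dense_open (\<lambda>\<omega>. Lueroth_expansion c p \<omega> x \<noteq> a)"
  unfolding dense_open_def
proof (intro ballI allI)
  fix \<omega> n assume \<omega>: "\<omega> \<in> Omega"
  obtain m where m: "m \<ge> n" "orbit c \<omega> x m \<in> switch_region c"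
    using orbit_hits_switch_region[OF c x] by blast
  obtain b :: nat where b: "b \<in> {0, 1}" "b \<noteq> fst (a m)" by (metis insertCI zero_neq_one)
  show "\<exists>\<omega>'\<in>Omega. \<exists>n'. (\<forall>i<n. \<omega>' i = \<omega> i) \<and>
     (\<forall>\<omega>''\<in>Omega. (\<forall>i<n'. \<omega>'' i = \<omega>' i) \<longrightarrow> Lueroth_expansion c p \<omega>'' x \<noteq> a)"
  proof (intro bexI exI conjI allI impI ballI)
    show "fun_upd \<omega> m b \<in> Omega" using \<omega> b by (auto simp: Omega_def)
    show "(fun_upd \<omega> m b) i = \<omega> i" if "i < n" for i using that m by simp
    fix \<omega>'' assume w: "\<forall>i<Suc m. \<omega>'' i = (fun_upd \<omega> m b) i"
    then have "orbit c \<omega>'' x m = orbit c \<omega> x m" by (intro orbit_cong) auto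
    then have "fst (Lueroth_expansion c p \<omega>'' x m) = b"
      using m(2) w by (simp add: Lueroth_expansion_eq sign_digit_def)
    then show "Lueroth_expansion c p \<omega>'' x \<noteq> a" using b by auto
  qed
qed

section \<open>Prescribed blocks\<close>

text \<open>The block is read from \<open>y\<close> when its own signs serve as the random
  digits.\<close>

primrec emits :: "real \<Rightarrow> (nat \<times> nat) list \<Rightarrow> real \<Rightarrow> bool" where
  "emits c [] y \<longleftrightarrow> True"
| "emits c (a # B) y \<longleftrightarrow> sign_digit c (\<lambda>_. fst a, y) = fst a \<and> Lueroth_digit (\<lambda>_. fst a, y) = snd a \<and>
     emits c B (step c (fst a) y)"

lemma emits_expansion:
  assumes "emits c B (orbit c \<omega> x k)" "\<And>i. i < length B \<Longrightarrow> \<omega> (k + i) = fst (B ! i)" "i < length B"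
  shows "Lueroth_expansion c p \<omega> x (k + i) = B ! i"
  using assms
proof (induction B arbitrary: k i)
  case (Cons a B)
  have k: "\<omega> k = fst a" using Cons.prems(2)[of 0] by simp
  show ?case
  proof (cases i)
    case 0
    then show ?thesis using Cons.prems(1) k by (simp add: Lueroth_expansion_eq)
  next
    case (Suc j)
    have "emits c B (orbit c \<omega> x (Suc k))" using Cons.prems(1) k by simp
    moreover have "\<omega> (Suc k + i) = fst (B ! i)" if "i < length B" for i
      using Cons.prems(2)[of "Suc i"] that by simp
    ultimately have "Lueroth_expansion c p \<omega> x (Suc k + j) = B ! j" using Cons.prems(3) Suc by (intro Cons.IH) auto
    then show ?thesis using Suc by simp
  qed
qed simp

text \<open>The interval is pulled back through the inverse branches, from the last entry to the
  first. All target values stay at least \<open>c\<close>, so each prescribed sign is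
  admissible.\<close>

lemma emits_interval:
  assumes l: "l \<ge> 3" "c = 1 / real l" and B: "set B \<subseteq> alphabet c"
  shows "\<exists>a b. c \<le> a \<and> a < b \<and> b \<le> 1 \<and> (\<forall>y. y \<notin> \<rat> \<longrightarrow> a < y \<longrightarrow> y < b \<longrightarrow> emits c B y)"
  using B
proof (induction B)
  case Nil
  have "c < 1" using l by simp
  then show ?case by auto
next
  case (Cons sd B)
  obtain s d where sd: "sd = (s, d)" by fastforce
  have c: "0 < c" "c \<le> 1/2" unfolding l(2) using l(1) by (auto simp: field_simps)
  have s: "s \<in> {0, 1}" and d: "d \<ge> 2" "d \<le> l" using Cons.prems sd l by (auto simp: alphabet_def)
  obtain a b where ab: "c \<le> a" "a < b" "b \<le> 1" "\<And>y. y \<notin> \<rat> \<Longrightarrow> a < y \<Longrightarrow> y < b \<Longrightarrow> emits c B y"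
    using Cons by auto
  define h where "h = z (d - 1) - z d"
  have h: "h > 0" unfolding h_def by (rule z_pred_minus_z[OF d(1)])
  \<comment> \<open>With \<open>c = 1 / l\<close> every branch allowed by the alphabet lies entirely
    in \<open>{c..1}\<close>.\<close>
  have zd: "c \<le> z d" unfolding z_def l(2) using d by (intro divide_left_mono) auto
  have zd1: "z d + h \<le> 1" using d by (simp add: h_def z_def)
  \<comment> \<open>The range required of \<open>T_L y\<close>; sign 1 reflects the target
    interval.\<close>
  define a' b' where "a' = (if s = 0 then a else 1 - b)" and "b' = (if s = 0 then b else 1 - a)"
  have ab': "0 \<le> a'" "a' < b'" "b' \<le> 1" using ab c by (auto simp: a'_def b'_def)
  have "emits c (sd # B) y" if y: "y \<notin> \<rat>" "z d + a' * h < y" "y < z d + b' * h" for y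
  proof -
    have "0 \<le> a' * h" "b' * h \<le> 1 * h" using ab' h by (auto intro: mult_right_mono simp del: mult_1)
    then have yd: "y \<in> {z d..<z (d - 1)}" and yc: "y \<in> {c..1}" using y zd zd1 by (auto simp: h_def)
    then have irr: "y \<in> irrationals_from c" using y by (simp add: irrationals_from_def)
    have "y = z d + T_L y * h" unfolding h_def by (rule T_L_branch(2)[OF d(1) yd])
    then have "a' * h < T_L y * h" "T_L y * h < b' * h" using y by linarith+
    then have t: "a' < T_L y" "T_L y < b'" using h by auto
    define v where "v = (if s = 0 then T_L y else 1 - T_L y)"
    have v: "a < v" "v < b" using t by (auto simp: v_def a'_def b'_def split: if_splits)
    then have "step c s y = v" "sign_digit c (\<lambda>_. s, y) = s"
      using step_select[OF c irr s, of "\<lambda>_. s"] ab by (auto simp: v_def)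
    moreover have "emits c B v" using ab(4) v step_irrationals_from[OF c irr, of s] \<open>step c s y = v\<close>
      by (simp add: irrationals_from_def)
    ultimately show ?thesis using Lueroth_digit_eq[OF d(1) yd] by (simp add: sd)
  qed
  moreover have "c \<le> z d + a' * h" using zd ab' h by (simp add: add_increasing2)
  moreover have "z d + a' * h < z d + b' * h" using ab' h by simp
  moreover have "b' * h \<le> 1 * h" using ab' h by (intro mult_right_mono) auto
  then have "z d + b' * h \<le> 1" using zd1 by simp
  ultimately show ?case by blast
qed

section \<open>Density of reachable points\<close>

definition reachable :: "real \<Rightarrow> real \<Rightarrow> real set" where
  "reachable c y = {fold (step c) w y | w. set w \<subseteq> {0, 1}}"

lemma reachable_irrationals_from:
  assumes "0 < c" "c \<le> 1/2" "y \<in> irrationals_from c" "v \<in> reachable c y"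
  shows "v \<in> irrationals_from c"
proof -
  have "fold (step c) w y \<in> irrationals_from c" for w
    by (induction w rule: rev_induct) (use assms step_irrationals_from in auto)
  then show ?thesis using assms(4) by (auto simp: reachable_def)
qed

lemma reachable_select:
  assumes c: "0 < c" "c \<le> 1/2" and y: "y \<in> irrationals_from c" and v: "v \<in> reachable c y"
    and v': "v' = T_L v \<or> v' = 1 - T_L v" "c \<le> v'"
  shows "v' \<in> reachable c y"
proof -
  obtain w where w: "v = fold (step c) w y" "set w \<subseteq> {0, 1}" using v by (auto simp: reachable_def)
  define s :: nat where "s = (if v' = T_L v then 0 else 1)"
  have "step c s v = v'"
    using step_select(1)[OF c reachable_irrationals_from[OF c y v], of s "\<lambda>_. s"] v' by (auto simp: s_def split: if_splits)
  then have "v' = fold (step c) (w @ [s]) y" using w by simp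
  moreover have "set (w @ [s]) \<subseteq> {0, 1}" using w by (simp add: s_def)
  ultimately show ?thesis unfolding reachable_def by blast
qed

text \<open>A choice between \<open>t\<close> and \<open>1 - t\<close> is postponed by passing to the classes of \<open>\<real> / \<int>\<close> up to sign.\<close>

definition free_classes :: "real \<Rightarrow> real \<Rightarrow> real set" where
  "free_classes c y = {v. \<forall>y'\<in>{c..1}. \<forall>m::int. y' = of_int m + v \<or> y' = of_int m - v \<longrightarrow> y' \<in> reachable c y}"

lemma free_classesD:
  assumes "v \<in> free_classes c y" "c \<le> y'" "y' \<le> 1" "y' = of_int m + v \<or> y' = of_int m - v"
  shows "y' \<in> reachable c y"
proof -
  have "y' \<in> {c..1}" using assms by simp
  with assms(1,4) show ?thesis unfolding free_classes_def by blast
qed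

text \<open>As \<open>T_L u\<close> lies in \<open>(0, 1)\<close>, the only points of
  \<open>{c..1}\<close> congruent to it up to sign are \<open>T_L u\<close> and
  \<open>1 - T_L u\<close>, and either can be selected when at least \<open>c\<close>.\<close>

lemma free_classesI:
  assumes c: "0 < c" "c \<le> 1/2" and y: "y \<in> irrationals_from c" and u: "u \<in> reachable c y"
    and v: "T_L u = of_int m + v \<or> T_L u = of_int m - v"
  shows "v \<in> free_classes c y"
  unfolding free_classes_def
proof (intro CollectI ballI allI impI)
  fix y' and k :: int assume y': "y' \<in> {c..1}" "y' = of_int k + v \<or> y' = of_int k - v"
  have t: "0 < T_L u" "T_L u < 1" using T_L_irrational[OF c(1) reachable_irrationals_from[OF c y u]] by auto
  obtain j :: int where j: "y' = T_L u + of_int j \<or> y' = of_int j - T_L u"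
  proof -
    have "y' = T_L u + of_int (k - m) \<or> y' = of_int (k + m) - T_L u" using v y'(2) by auto
    then show ?thesis using that by blast
  qed
  have "y' = T_L u \<or> y' = 1 - T_L u"
    using j
  proof
    assume e: "y' = T_L u + of_int j"
    then have "real_of_int j < 1" "real_of_int j > -1" using t y'(1) c by auto
    then have "j = 0" by linarith
    then show ?thesis using e by simp
  next
    assume e: "y' = of_int j - T_L u"
    then have "real_of_int j < 2" "real_of_int j > 0" using t y'(1) c by auto
    then have "j = 1" by linarith
    then show ?thesis using e by simp
  qed
  then show "y' \<in> reachable c y" using reachable_select[OF c y u] y'(1) by auto
qed

text \<open>The class has a representative \<open>u\<close> in \<open>[1/2, 1)\<close>, which is
  reachable because \<open>c \<le> 1/2\<close>; on branch 2 the map is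
  \<open>2 * u - 1\<close>.\<close>

lemma free_classes_double:
  assumes c: "0 < c" "c \<le> 1/2" and y: "y \<in> irrationals_from c" and v: "v \<in> free_classes c y" "v \<notin> \<rat>"
  shows "2 * v \<in> free_classes c y"
proof -
  define w where "w = frac v"
  have "v \<notin> \<int>" using v(2) Ints_subset_Rats by blast
  then have w: "0 < w" "w < 1" "v = of_int \<lfloor>v\<rfloor> + w"
    unfolding w_def by (simp_all add: frac_gt_0_iff frac_lt_1) (simp add: frac_def)
  define u where "u = (if w \<ge> 1/2 then w else 1 - w)"
  have u: "1/2 \<le> u" "u < 1" using w by (auto simp: u_def)
  have "u = of_int (- \<lfloor>v\<rfloor>) + v \<or> u = of_int (1 + \<lfloor>v\<rfloor>) - v" using w(3) by (auto simp: u_def)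
  then obtain k' :: int where "u = of_int k' + v \<or> u = of_int k' - v" by blast
  then have "u \<in> reachable c y" using u c by (intro free_classesD[OF v(1)]) auto
  moreover have "T_L u = 2 * u - 1" using T_L_branch(1)[of 2 u] u by (simp add: z_def)
  then have "T_L u = of_int (- 2 * \<lfloor>v\<rfloor> - 1) + 2 * v \<or> T_L u = of_int (1 + 2 * \<lfloor>v\<rfloor>) - 2 * v"
    using w(3) by (auto simp: u_def)
  then obtain m :: int where "T_L u = of_int m + 2 * v \<or> T_L u = of_int m - 2 * v" by blast
  ultimately show ?thesis by (rule free_classesI[OF c y])
qed

text \<open>The class has a representative \<open>u\<close> in \<open>[1/3, 1/2)\<close>, reachable
  because \<open>c \<le> 1/3\<close>; on branch 3 the map is \<open>6 * u - 2\<close>. Irrationality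
  excludes the endpoint \<open>1/2\<close>.\<close>

lemma free_classes_six:
  assumes c: "0 < c" "c \<le> 1/3" and y: "y \<in> irrationals_from c" and v: "v \<in> free_classes c y" "v \<notin> \<rat>"
    and k: "1/3 \<le> v - of_int k" "v - of_int k \<le> 2/3"
  shows "6 * v \<in> free_classes c y"
proof -
  have c2: "c \<le> 1/2" using c by simp
  define w where "w = v - of_int k"
  have "w \<noteq> 1/2"
  proof
    assume "w = 1/2"
    then have "v = 1/2 + of_int k" by (simp add: w_def)
    then show False using v(2) by (metis Rats_add Rats_of_int Rats_divide Rats_1 Rats_number_of)
  qed
  define u where "u = (if w < 1/2 then w else 1 - w)"
  have u: "1/3 \<le> u" "u < 1/2" using \<open>w \<noteq> 1/2\<close> k by (auto simp: u_def w_def)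
  have "u = of_int (- k) + v \<or> u = of_int (1 + k) - v" by (auto simp: u_def w_def)
  then obtain k' :: int where "u = of_int k' + v \<or> u = of_int k' - v" by blast
  then have "u \<in> reachable c y" using u c by (intro free_classesD[OF v(1)]) auto
  moreover have "T_L u = 6 * u - 2" using T_L_branch(1)[of 3 u] u by (simp add: z_def)
  then have "T_L u = of_int (- 6 * k - 2) + 6 * v \<or> T_L u = of_int (4 + 6 * k) - 6 * v"
    by (auto simp: u_def w_def)
  then obtain m :: int where "T_L u = of_int m + 6 * v \<or> T_L u = of_int m - 6 * v" by blast
  ultimately show ?thesis by (rule free_classesI[OF c(1) c2 y])
qed

text \<open>Let \<open>d\<close> be the distance of \<open>v\<close> to the nearest integer. The
  first \<open>2 ^ j * d\<close> that is at least \<open>1/3\<close> is at most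
  \<open>2/3\<close>.\<close>

lemma doubling_hits_middle_third:
  fixes v :: real
  assumes "v \<notin> \<rat>"
  shows "\<exists>j. \<exists>k::int. 1/3 \<le> 2 ^ j * v - of_int k \<and> 2 ^ j * v - of_int k \<le> 2/3"
proof -
  define w where "w = frac v"
  have "v \<notin> \<int>" using assms Ints_subset_Rats by blast
  then have w: "0 < w" "w < 1" "v = of_int \<lfloor>v\<rfloor> + w"
    unfolding w_def by (simp_all add: frac_gt_0_iff frac_lt_1) (simp add: frac_def)
  then obtain q :: int where q: "v = of_int q + w" by blast
  define d where "d = min w (1 - w)"
  have d: "0 < d" "d \<le> 1/2" using w by (auto simp: d_def min_def)
  have "\<exists>j. 1/3 \<le> 2 ^ j * d \<and> 2 ^ j * d \<le> 2/3"
  proof -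
    have ex: "\<exists>j. 1/3 \<le> 2 ^ j * d"
    proof -
      obtain j where "1 / d < 2 ^ j" using real_arch_pow[of 2 "1 / d"] by auto
      then have "1/3 \<le> 2 ^ j * d" using d by (simp add: field_simps)
      then show ?thesis by blast
    qed
    define j where "j = (LEAST j. 1/3 \<le> 2 ^ j * d)"
    have j: "1/3 \<le> 2 ^ j * d" unfolding j_def using ex by (rule LeastI_ex)
    have "2 ^ j * d \<le> 2/3"
    proof (cases j)
      case 0
      then show ?thesis using d by simp
    next
      case (Suc i)
      then have "\<not> 1/3 \<le> 2 ^ i * d" using not_less_Least[of i "\<lambda>j. 1/3 \<le> 2 ^ j * d"] by (simp add: j_def)
      moreover have "2 ^ j * d = 2 * (2 ^ i * d)" using Suc by simp
      ultimately show ?thesis by linarith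
    qed
    with j show ?thesis by blast
  qed
  then obtain j where j: "1/3 \<le> 2 ^ j * d" "2 ^ j * d \<le> 2/3" by blast
  show ?thesis
  proof (cases "d = w")
    case True
    have "2 ^ j * v - of_int (2 ^ j * q) = 2 ^ j * d" using q True by (simp add: algebra_simps)
    then show ?thesis using j by metis
  next
    case False
    then have "d = 1 - w" by (auto simp: d_def min_def split: if_splits)
    then have vq: "v = of_int q + 1 - d" using q by simp
    \<comment> \<open>If the nearest integer lies above \<open>v\<close>, the middle third is
      reached by its reflection.\<close>
    have "2 ^ j * v - of_int (2 ^ j * (q + 1) - 1) = 1 - 2 ^ j * d" unfolding vq by (simp add: algebra_simps)
    moreover have "1/3 \<le> 1 - 2 ^ j * d" "1 - 2 ^ j * d \<le> 2/3" using j by auto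
    ultimately show ?thesis by metis
  qed
qed

lemma power_2_3_irrational:
  assumes "(v::real) \<notin> \<rat>" shows "2 ^ i * 3 ^ j * v \<notin> \<rat>"
proof
  assume "2 ^ i * 3 ^ j * v \<in> \<rat>"
  then have "2 ^ i * 3 ^ j * v / (2 ^ i * 3 ^ j) \<in> \<rat>" by (intro Rats_divide) auto
  then show False using assms by simp
qed

text \<open>Doubling continues a row once it has started. Along row \<open>j\<close> some element
  falls in the middle third modulo 1, and multiplying it by 6 starts row
  \<open>j + 1\<close>.\<close>

lemma free_classes_rows:
  assumes c: "0 < c" "c \<le> 1/3" and y: "y \<in> irrationals_from c" and v: "v \<in> free_classes c y" "v \<notin> \<rat>"
  shows "\<exists>N. \<forall>i\<ge>N. 2 ^ i * 3 ^ j * v \<in> free_classes c y"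
proof -
  have c2: "c \<le> 1/2" using c by simp
  have up: "\<forall>i\<ge>N. 2 ^ i * 3 ^ j * v \<in> free_classes c y" if N: "2 ^ N * 3 ^ j * v \<in> free_classes c y" for N j
  proof (intro allI impI)
    fix i assume "i \<ge> N"
    then show "2 ^ i * 3 ^ j * v \<in> free_classes c y"
    proof (induction i rule: dec_induct)
      case (step i)
      then show ?case
        using free_classes_double[OF c(1) c2 y step.IH power_2_3_irrational[OF v(2)]] by (simp add: mult_ac)
    qed (rule N)
  qed
  show ?thesis
  proof (induction j)
    case 0
    show ?case using up[of 0 0] v by auto
  next
    case (Suc j)
    then obtain N where N: "\<And>i. i \<ge> N \<Longrightarrow> 2 ^ i * 3 ^ j * v \<in> free_classes c y" by blast
    obtain i k where ik: "1/3 \<le> 2 ^ i * (2 ^ N * 3 ^ j * v) - of_int k" "2 ^ i * (2 ^ N * 3 ^ j * v) - of_int k \<le> 2/3"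
      using doubling_hits_middle_third[OF power_2_3_irrational[OF v(2)]] by blast
    have eq: "2 ^ i * (2 ^ N * 3 ^ j * v) = 2 ^ (i + N) * 3 ^ j * v" by (simp add: power_add)
    have "6 * (2 ^ (i + N) * 3 ^ j * v) \<in> free_classes c y"
      using free_classes_six[OF c y N power_2_3_irrational[OF v(2)]] ik unfolding eq by simp
    then have "2 ^ Suc (i + N) * 3 ^ Suc j * v \<in> free_classes c y" by (simp add: mult_ac)
    then show ?case using up by blast
  qed
qed

text \<open>The tails of the rows of \<open>T_L y\<close> are dense modulo 1, and a representative
  of a free class inside \<open>{c..1}\<close> is reachable.\<close>

lemma reachable_dense:
  assumes c: "0 < c" "c \<le> 1/3" and y: "y \<in> irrationals_from c" and ab: "c \<le> a" "a < b" "b \<le> 1"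
  shows "\<exists>v\<in>reachable c y. a < v \<and> v < b"
proof -
  have c2: "c \<le> 1/2" using c by simp
  have "y \<in> reachable c y" unfolding reachable_def by (rule CollectI, rule exI[of _ "[]"]) simp
  then have T: "T_L y \<in> free_classes c y" using free_classesI[OF c(1) c2 y, of y 0] by simp
  have irr: "T_L y \<notin> \<rat>" by (rule T_L_irrational[OF c(1) y])
  obtain N where N: "\<And>j i. i \<ge> N j \<Longrightarrow> 2 ^ i * 3 ^ j * T_L y \<in> free_classes c y"
    using free_classes_rows[OF c y T irr] by metis
  obtain i j and m :: int where ijm: "i \<ge> N j" "a < 2 ^ i * 3 ^ j * T_L y + m" "2 ^ i * 3 ^ j * T_L y + m < b"
    using tails_times_2_times_3_dense[OF irr ab(2), of N] by blast
  then have "m + 2 ^ i * 3 ^ j * T_L y \<in> reachable c y"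
    using ab by (intro free_classesD[OF N[OF ijm(1)], of _ m]) auto
  then show ?thesis using ijm by (intro bexI) auto
qed

section \<open>Universality and uncountability\<close>

text \<open>After any prefix the orbit is steered into the interval that emits \<open>B\<close>, and
  the signs of \<open>B\<close> are then used as digits.\<close>

lemma dense_open_block:
  assumes l: "l \<ge> 3" "c = 1 / real l" and x: "x \<in> irrationals_from c" and B: "set B \<subseteq> alphabet c"
  shows "dense_open (\<lambda>\<omega>. \<exists>k. \<forall>i<length B. Lueroth_expansion c p \<omega> x (k + i) = B ! i)"
  unfolding dense_open_def
proof (intro ballI allI)
  fix \<omega> n assume \<omega>: "\<omega> \<in> Omega"
  have c: "0 < c" "c \<le> 1/3" "c \<le> 1/2" unfolding l(2) using l(1) by (auto simp: field_simps)
  obtain a b where ab: "c \<le> a" "a < b" "b \<le> 1" "\<And>y. y \<notin> \<rat> \<Longrightarrow> a < y \<Longrightarrow> y < b \<Longrightarrow> emits c B y"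
    using emits_interval[OF l B] by blast
  define y where "y = orbit c \<omega> x n"
  have y: "y \<in> irrationals_from c" unfolding y_def by (rule orbit_irrationals_from[OF c(1,3) x])
  obtain v where v: "v \<in> reachable c y" "a < v" "v < b" using reachable_dense[OF c(1,2) y ab(1-3)] by blast
  then have emits: "emits c B v"
    using ab(4) reachable_irrationals_from[OF c(1,3) y v(1)] by (auto simp: irrationals_from_def)
  obtain w where w: "v = fold (step c) w y" "set w \<subseteq> {0, 1}" using v(1) by (auto simp: reachable_def)
  define u where "u = w @ map fst B"
  have u: "u ! i \<in> {0, 1}" if "i < length u" for i
  proof -
    have "set u \<subseteq> {0, 1}" using w(2) B by (auto simp: u_def alphabet_def)
    then show ?thesis using nth_mem[OF that] by blast
  qed
  define \<omega>' where "\<omega>' i = (if i < n then \<omega> i else if i - n < length u then u ! (i - n) else 0)" for i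
  show "\<exists>\<omega>'\<in>Omega. \<exists>n'. (\<forall>i<n. \<omega>' i = \<omega> i) \<and> (\<forall>\<omega>''\<in>Omega. (\<forall>i<n'. \<omega>'' i = \<omega>' i) \<longrightarrow>
     (\<exists>k. \<forall>i<length B. Lueroth_expansion c p \<omega>'' x (k + i) = B ! i))"
  proof (intro bexI exI conjI allI impI ballI)
    show "\<omega>' \<in> Omega" using \<omega> u unfolding Omega_def \<omega>'_def by auto
    show "\<omega>' i = \<omega> i" if "i < n" for i using that by (simp add: \<omega>'_def)
    fix \<omega>'' i assume agree: "\<forall>i<n + length u. \<omega>'' i = \<omega>' i" and i: "i < length B"
    have "orbit c \<omega>'' x n = y" unfolding y_def using agree by (intro orbit_cong) (simp add: \<omega>'_def)
    moreover have "\<omega>'' (n + i) = w ! i" if "i < length w" for i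
      using agree that by (simp add: \<omega>'_def u_def nth_append)
    ultimately have "orbit c \<omega>'' x (n + length w) = v" using orbit_fold_step[of w \<omega>'' n c x] w by simp
    moreover have "\<omega>'' (n + length w + i) = fst (B ! i)" if "i < length B" for i
      using agree that by (simp add: \<omega>'_def u_def nth_append)
    ultimately show "Lueroth_expansion c p \<omega>'' x (n + length w + i) = B ! i"
      using emits i by (intro emits_expansion) auto
  qed
qed

text \<open>If the set were countable, avoiding each member would add only countably many
  conditions; a sequence meeting them all has an expansion in the set that differs from
  itself.\<close>

lemma uncountable_expansions:
  assumes c: "0 < c" "c \<le> 2/5" and x: "x \<in> irrationals_from c"
    and D: "countable D" "\<And>P. P \<in> D \<Longrightarrow> dense_open P"
  shows "uncountable {Lueroth_expansion c p \<omega> x | \<omega>. \<omega> \<in> Omega \<and> (\<forall>P\<in>D. P \<omega>)}" (is "uncountable ?E")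
proof
  assume count: "countable ?E"
  define C where "C = D \<union> (\<lambda>a \<omega>. Lueroth_expansion c p \<omega> x \<noteq> a) ` ?E"
  have "countable C" unfolding C_def using count D by blast
  moreover have "dense_open P" if "P \<in> C" for P
    using that D dense_open_expansion_neq[OF c x] unfolding C_def by blast
  ultimately obtain \<omega> where \<omega>: "\<omega> \<in> Omega" "\<And>P. P \<in> C \<Longrightarrow> P \<omega>" using Baire_Omega[of C] by blast
  then have "Lueroth_expansion c p \<omega> x \<in> ?E" unfolding C_def by blast
  then have "(\<lambda>\<omega>'. Lueroth_expansion c p \<omega>' x \<noteq> Lueroth_expansion c p \<omega> x) \<in> C" unfolding C_def by blast
  then show False using \<omega>(2) by blast
qed

theorem theorem3:
  fixes c p :: real
  assumes "0 < c" and "0 < p" and "p < 1"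
  shows "(c \<le> 2 / 5 \<longrightarrow>
           (\<forall>x\<in>{c..1}. x \<notin> \<rat> \<longrightarrow>
              uncountable {Lueroth_expansion c p \<omega> x | \<omega>. \<omega> \<in> Omega}))
       \<and> ((\<exists>l::nat. l \<ge> 3 \<and> c = 1 / real l) \<longrightarrow>
           (\<forall>x\<in>{c..1}. x \<notin> \<rat> \<longrightarrow>
              uncountable {Lueroth_expansion c p \<omega> x | \<omega>.
                \<omega> \<in> Omega \<and> universal_expansion c (Lueroth_expansion c p \<omega> x)}))"
proof (intro conjI impI ballI)
  fix x assume "c \<le> 2 / 5" "x \<in> {c..1}" "x \<notin> \<rat>"
  then show "uncountable {Lueroth_expansion c p \<omega> x | \<omega>. \<omega> \<in> Omega}"
    using uncountable_expansions[of c x "{}" p] assms by (simp add: irrationals_from_def)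
next
  fix x assume "\<exists>l::nat. l \<ge> 3 \<and> c = 1 / real l" and x: "x \<in> {c..1}" "x \<notin> \<rat>"
  then obtain l :: nat where l: "l \<ge> 3" "c = 1 / real l" by blast
  have c: "c \<le> 2/5" unfolding l(2) using l(1) by (simp add: field_simps)
  have irr: "x \<in> irrationals_from c" using x by (simp add: irrationals_from_def)
  define D where "D = (\<lambda>B \<omega>. \<exists>k. \<forall>i<length B. Lueroth_expansion c p \<omega> x (k + i) = B ! i) ` {B. set B \<subseteq> alphabet c}"
  \<comment> \<open>Blocks are lists over a countable type, so universality is a countable
    conjunction of dense open conditions.\<close>
  have "countable D" unfolding D_def by (intro countable_image countableI_type)
  moreover have "dense_open P" if "P \<in> D" for P using that dense_open_block[OF l irr] unfolding D_def by blast
  ultimately have "uncountable {Lueroth_expansion c p \<omega> x | \<omega>. \<omega> \<in> Omega \<and> (\<forall>P\<in>D. P \<omega>)}"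
    using uncountable_expansions[OF assms(1) c irr] by blast
  moreover have "(\<forall>P\<in>D. P \<omega>) \<longleftrightarrow> universal_expansion c (Lueroth_expansion c p \<omega> x)" for \<omega>
    by (simp add: D_def universal_expansion_def)
  ultimately show "uncountable {Lueroth_expansion c p \<omega> x | \<omega>.
      \<omega> \<in> Omega \<and> universal_expansion c (Lueroth_expansion c p \<omega> x)}" by simp
qed

end
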